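(* Let $G=(V,E)$ be a homogeneous chordal graph with $V=\{1,\dots,n\}$ and let $\mathcal{F}$ be a face of $\pi_G(\mathcal{S}^n_+)$. Then $\mathcal{F}$ is projectionally exposed and there exists an automorphism $Q$ of $\pi_G(\mathcal{S}^n_+)$ that maps $\mathcal{F}$ to $\pi_H(\mathcal{S}^n_+)$, where $H$ is an induced subgraph of $G$. Additionally, if the vertices of $G$ are in a trivially perfect elimination ordering, the following hold. (i) $Q$ can be assumed to be of the form $Q=Q_u$ for some $u\in\mathcal{T}_{++}(G)$. In particular, $Q_u(y)=\pi_G(uyu^* )$ holds for $y\in\pi_G(\mathcal{S}^n_+)$. (ii) Suppose that $x\in\operatorname{ri}\mathcal{F}$. Then $x=\pi_G(tt^* )$ holds for a unique proper matrix $t\in\mathcal{T}_+(G)$. Letting $I=\{i\mid t_{ii}=0\}$, $H$ is the subgraph obtained by removing the vertices belonging to $I$. Furthermore, $u$ in item (i) can be taken to be any $u\in\mathcal{T}_{++}(G)$ satisfying $ut=e_I$, where $e_I$ is the diagonal matrix that has $1$ in its $(i,i)$ component if $i\notin I$ and zero elsewhere. Moreover, for $x\in\operatorname{ri}\mathcal{F}$, $t$ the unique proper matrix in $\mathcal{T}_+(G)$ with $x=\pi_G(tt^* )$, and $r=|\{i\mid t_{ii}\ne0\}|$: (iii) The maximum possible rank of a PSD completion of $x$ is $r$, and $tt^*$ is a maximum rank completion. (iv) If $r=n$, then $tt^*$ is the maximum determinant completion of $x$.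
   Context: $G=(V,E)$ is a finite simple undirected graph with $V=\{1,\dots,n\}$. It is homogeneous chordal if it is chordal and has no induced subgraph isomorphic to a path on $4$ vertices. The vertices are in a trivially perfect elimination ordering if (o1) $\{i,j\},\{i,k\}\in E$ and $i<j<k$ imply $\{j,k\}\in E$, and (o2) $\{i,j\},\{j,k\}\in E$ and $i<j<k$ imply $\{i,k\}\in E$. $\mathcal{S}^n_+$ is the cone of real symmetric positive semidefinite (PSD) $n\times n$ matrices. $\pi_G$ is the map that sets to zero all $(i,j)$ entries of an $n\times n$ matrix with $i\ne j$, $\{i,j\}\notin E$. The ambient space of $\pi_G(\mathcal{S}^n_+)$ is $\mathcal{S}(G)$, the space of real symmetric $n\times n$ matrices whose $(i,j)$ entries vanish for all $i\neq j$, $\{i,j\}\notin E$. A PSD completion of $x\in\pi_G(\mathcal{S}^n_+)$ is any $w\in\mathcal{S}^n_+$ with $\pi_G(w)=x$; the maximum determinant completion is the PSD completion maximizing the determinant. $a^*$ denotes the transpose of $a$. For an induced subgraph $H=(\hat V,\hat E)$ of $G$ (possibly empty or all of $G$), $\pi_H(\mathcal{S}^n_+)=\{x\in\pi_G(\mathcal{S}^n_+): x_{ij}=x_{ji}=0\ \forall i,j\notin\hat V\}$; equivalently, $x\in\pi_H(\mathcal{S}^n_+)$ iff $x$ has a PSD completion $w$ with $w_{ii}=0$ for $i\notin\hat V$. $\mathcal{T}_+(G)$ (resp. $\mathcal{T}_{++}(G)$) is the set of real upper triangular $n\times n$ matrices $u$ with nonnegative (resp. positive) diagonal and with $u_{ij}=0$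 whenever $i\ne j$ and $\{i,j\}\notin E$. A matrix $t\in\mathcal{T}_+(G)$ is proper if $t_{ii}=0$ implies that the $i$-th column of $t$ is zero. With $a\star b=\pi_G(ab)$, for $u\in\mathcal{T}_{++}(G)$ the linear map $Q_u:\mathcal{S}(G)\to\mathcal{S}(G)$ is $Q_u(b)=\tfrac12(c+c^* )$ with $c=u\star(b\star u^* )+u\star(u\star b)-(u\star u)\star b$. A face of a convex cone $\mathcal{K}$ is a nonempty convex cone $\mathcal{F}\subseteq\mathcal{K}$ such that $x,y\in\mathcal{K}$, $x+y\in\mathcal{F}$ imply $x,y\in\mathcal{F}$. $\mathcal{F}$ is projectionally exposed if there is a linear map $\mathcal{P}$ of the ambient space to itself with $\mathcal{P}^2=\mathcal{P}$ and $\mathcal{P}(\mathcal{K})=\mathcal{F}$. An automorphism of $\mathcal{K}$ is a linear bijection of the ambient space mapping $\mathcal{K}$ onto itself. $\operatorname{ri}$ is the relative interior. *)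

theory Defs
  imports "HOL-Analysis.Analysis"
begin

text \<open>
  The vertex set \<open>{1, \<dots>, n}\<close> is rendered as the universe of a finite linearly ordered index
  type \<open>'n\<close>, the usual order on the vertices being the order of the type. A graph on these
  vertices is given by its edge set.
\<close>

section \<open>Graphs\<close>

definition simple_graph :: "'a set set \<Rightarrow> bool" where
  "simple_graph E \<longleftrightarrow> (\<forall>e\<in>E. card e = 2)"

definition induced_edges :: "'a set set \<Rightarrow> 'a set \<Rightarrow> 'a set set" where
  "induced_edges E W = {e \<in> E. e \<subseteq> W}"

definition graph_isomorphic :: "'a set \<Rightarrow> 'a set set \<Rightarrow> 'b set \<Rightarrow> 'b set set \<Rightarrow> bool" where
  "graph_isomorphic V E W D \<longleftrightarrow>
     (\<exists>f. bij_betw f V W \<and> (\<forall>x\<in>V. \<forall>y\<in>V. {x, y} \<in> E \<longleftrightarrow> {f x, f y} \<in> D))"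

definition path_edges :: "nat \<Rightarrow> nat set set" where
  "path_edges k = {{i, Suc i} | i. Suc i < k}"

definition is_cycle :: "'a set set \<Rightarrow> 'a list \<Rightarrow> bool" where
  "is_cycle E vs \<longleftrightarrow> 3 \<le> length vs \<and> distinct vs \<and>
     (\<forall>i < length vs. {vs ! i, vs ! (Suc i mod length vs)} \<in> E)"

definition has_chord :: "'a set set \<Rightarrow> 'a list \<Rightarrow> bool" where
  "has_chord E vs \<longleftrightarrow>
     (\<exists>i < length vs. \<exists>j < length vs. i \<noteq> j \<and>
        j \<noteq> Suc i mod length vs \<and> i \<noteq> Suc j mod length vs \<and> {vs ! i, vs ! j} \<in> E)"

definition chordal :: "'a set set \<Rightarrow> bool" where
  "chordal E \<longleftrightarrow> (\<forall>vs. is_cycle E vs \<and> 4 \<le> length vs \<longrightarrow> has_chord E vs)"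

definition homogeneous_chordal :: "'a set set \<Rightarrow> bool" where
  "homogeneous_chordal E \<longleftrightarrow> chordal E \<and>
     \<not> (\<exists>W. graph_isomorphic {..<4} (path_edges 4) W (induced_edges E W))"

definition trivially_perfect_elim_ordering :: "'n::linorder set set \<Rightarrow> bool" where
  "trivially_perfect_elim_ordering E \<longleftrightarrow>
     (\<forall>i j k. {i, j} \<in> E \<and> {i, k} \<in> E \<and> i < j \<and> j < k \<longrightarrow> {j, k} \<in> E) \<and>
     (\<forall>i j k. {i, j} \<in> E \<and> {j, k} \<in> E \<and> i < j \<and> j < k \<longrightarrow> {i, k} \<in> E)"

section \<open>Matrices with sparsity pattern and positive semidefinite completions\<close>

definition psd :: "real^'n^'n \<Rightarrow> bool" where
  "psd A \<longleftrightarrow> transpose A = A \<and> (\<forall>v. 0 \<le> v \<bullet> (A *v v))"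

definition pattern_proj :: "'n::finite set set \<Rightarrow> real^'n^'n \<Rightarrow> real^'n^'n" where
  "pattern_proj E A = (\<chi> i j. if i = j \<or> {i, j} \<in> E then A $ i $ j else 0)"

definition pattern_space :: "'n::finite set set \<Rightarrow> (real^'n^'n) set" where
  "pattern_space E = {A. transpose A = A \<and> (\<forall>i j. i \<noteq> j \<and> {i, j} \<notin> E \<longrightarrow> A $ i $ j = 0)}"

definition pattern_cone :: "'n::finite set set \<Rightarrow> (real^'n^'n) set" where
  "pattern_cone E = pattern_proj E ` {A. psd A}"

text \<open>
  The cone of an induced subgraph, which is determined by its vertex set \<open>W\<close>. The condition at
  \<open>i = j\<close> forces the rows and columns outside \<open>W\<close> of every positive semidefinite completion
  to vanish, so entries with just one index outside \<open>W\<close> are zero as well.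
\<close>
definition sub_cone :: "'n::finite set set \<Rightarrow> 'n set \<Rightarrow> (real^'n^'n) set" where
  "sub_cone E W =
     {x \<in> pattern_cone E. \<forall>i j. i \<notin> W \<and> j \<notin> W \<longrightarrow> x $ i $ j = 0 \<and> x $ j $ i = 0}"

definition psd_completion :: "'n::finite set set \<Rightarrow> real^'n^'n \<Rightarrow> real^'n^'n \<Rightarrow> bool" where
  "psd_completion E x w \<longleftrightarrow> psd w \<and> pattern_proj E w = x"

definition is_max_rank_completion :: "'n::finite set set \<Rightarrow> real^'n^'n \<Rightarrow> real^'n^'n \<Rightarrow> bool" where
  "is_max_rank_completion E x w \<longleftrightarrow> psd_completion E x w \<and>
     (\<forall>w'. psd_completion E x w' \<longrightarrow> rank w' \<le> rank w)"

definition is_max_det_completion :: "'n::finite set set \<Rightarrow> real^'n^'n \<Rightarrow> real^'n^'n \<Rightarrow> bool" where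
  "is_max_det_completion E x w \<longleftrightarrow> psd_completion E x w \<and>
     (\<forall>w'. psd_completion E x w' \<longrightarrow> det w' \<le> det w)"

definition T_plus :: "'n::{finite,linorder} set set \<Rightarrow> (real^'n::_^'n::_) set" where
  "T_plus E = {u. (\<forall>i j. j < i \<longrightarrow> u $ i $ j = 0) \<and> (\<forall>i. 0 \<le> u $ i $ i) \<and>
     (\<forall>i j. i \<noteq> j \<and> {i, j} \<notin> E \<longrightarrow> u $ i $ j = 0)}"

definition T_plusplus :: "'n::{finite,linorder} set set \<Rightarrow> (real^'n::_^'n::_) set" where
  "T_plusplus E = {u. (\<forall>i j. j < i \<longrightarrow> u $ i $ j = 0) \<and> (\<forall>i. 0 < u $ i $ i) \<and>
     (\<forall>i j. i \<noteq> j \<and> {i, j} \<notin> E \<longrightarrow> u $ i $ j = 0)}"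

definition proper_matrix :: "real^'n^'n \<Rightarrow> bool" where
  "proper_matrix t \<longleftrightarrow> (\<forall>i. t $ i $ i = 0 \<longrightarrow> column i t = 0)"

definition zero_diag :: "real^'n^'n \<Rightarrow> 'n set" where
  "zero_diag t = {i. t $ i $ i = 0}"

definition e_mat :: "'n set \<Rightarrow> real^'n^'n" where
  "e_mat I = (\<chi> i j. if i = j \<and> i \<notin> I then 1 else 0)"

definition star :: "'n::finite set set \<Rightarrow> real^'n^'n \<Rightarrow> real^'n^'n \<Rightarrow> real^'n^'n" where
  "star E a b = pattern_proj E (a ** b)"

text \<open>Only the values of \<open>Q_map E u\<close> on \<^term>\<open>pattern_space E\<close> are meaningful.\<close>
definition Q_map :: "'n::finite set set \<Rightarrow> real^'n^'n \<Rightarrow> real^'n^'n \<Rightarrow> real^'n^'n" where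
  "Q_map E u b =
     (let c = star E u (star E b (transpose u)) + star E u (star E u b) - star E (star E u u) b
      in (1/2) *\<^sub>R (c + transpose c))"

section \<open>Cones in a linear subspace of the type\<close>

definition cone_face :: "'a::real_vector set \<Rightarrow> 'a set \<Rightarrow> bool" where
  "cone_face F K \<longleftrightarrow> convex_cone F \<and> F \<subseteq> K \<and>
     (\<forall>x\<in>K. \<forall>y\<in>K. x + y \<in> F \<longrightarrow> x \<in> F \<and> y \<in> F)"

text \<open>In the following, \<open>S\<close> is the ambient space, a linear subspace of the type.\<close>

definition linear_endo :: "'a::real_vector set \<Rightarrow> ('a \<Rightarrow> 'a) \<Rightarrow> bool" where
  "linear_endo S f \<longleftrightarrow> f ` S \<subseteq> S \<and>
     (\<forall>x\<in>S. \<forall>y\<in>S. f (x + y) = f x + f y) \<and> (\<forall>c. \<forall>x\<in>S. f (c *\<^sub>R x) = c *\<^sub>R f x)"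

definition projectionally_exposed :: "'a::real_vector set \<Rightarrow> 'a set \<Rightarrow> 'a set \<Rightarrow> bool" where
  "projectionally_exposed S K F \<longleftrightarrow>
     (\<exists>P. linear_endo S P \<and> (\<forall>x\<in>S. P (P x) = P x) \<and> P ` K = F)"

definition cone_automorphism :: "'a::real_vector set \<Rightarrow> 'a set \<Rightarrow> ('a \<Rightarrow> 'a) \<Rightarrow> bool" where
  "cone_automorphism S K Q \<longleftrightarrow> linear_endo S Q \<and> bij_betw Q S S \<and> Q ` K = K"

end

theory Submission
  imports Defs
begin

text \<open>
  In a trivially perfect elimination ordering, the closed neighbourhood of a vertex is contained in
  that of every larger neighbour (\<open>tpeo_iff_nested\<close>). Because of this nestedness, the upper triangular
  matrices with the sparsity pattern of the graph are closed under products, those with positive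
  diagonal form a group, and the group acts on the pattern space by \<open>y \<mapsto> pattern_proj E (u y u\<^sup>*)\<close>:
  the entries of a completion outside the pattern do not influence the result
  (\<open>pattern_proj_congruence\<close>). The map \<^const>\<open>Q_map\<close> is this action (\<open>Q_map_eq_congruence\<close>), hence
  an automorphism of the cone.

  Cholesky elimination from the largest vertex downwards respects the pattern and shows that each
  element of the cone is \<open>pattern_proj E (t t\<^sup>*)\<close> for exactly one proper triangular \<open>t\<close>
  (\<open>psd_triangular_factor_above\<close>, \<open>triangular_factor_unique\<close>). A group element \<open>u\<close> with
  \<open>u t = e\<^sub>I\<close> moves this element to the diagonal 0-1 matrix \<open>e\<^sub>I\<close>
  (\<open>triangular_factor_normalizer\<close>, \<open>normalized_congruence\<close>), and all assertions about \<open>x\<close> reduce to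
  assertions about \<open>e\<^sub>I\<close>:

  \<^item> A face is determined by any of its relative interior points \<open>x\<close> as the set of those \<open>y\<close> in the
  cone for which some \<open>x - \<epsilon> y\<close> with \<open>\<epsilon> > 0\<close> is in the cone, and for \<open>e\<^sub>I\<close> this set is the coordinate face
  that belongs to the complement of \<open>I\<close> (\<open>Q_map_face\<close>). Coordinate faces are images of the projections
  that restrict a matrix to a block, and projectional exposedness is preserved by automorphisms.

  \<^item> The completions of \<open>e\<^sub>I\<close> vanish on the rows in \<open>I\<close>, which bounds the rank.

  \<^item> If \<open>I\<close> is empty, the completions have unit diagonal, and Hadamard's inequality, itself a
  consequence of the factorization for the complete graph, bounds the determinant.

  For a graph without a given ordering, the absence of induced paths on four vertices and of chordless
  cycles of length four makes the closed neighbourhoods of adjacent vertices comparable, so sorting by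
  degree is a trivially perfect elimination ordering, and the result is carried back along the
  relabelling (\<open>homogeneous_chordal_face_automorphism\<close>).
\<close>

section \<open>Nested neighbourhoods\<close>

text \<open>
  Reflexive closure of adjacency: the entries kept by \<^const>\<open>pattern_proj\<close> are exactly those
  with \<open>j \<in> closed_nbhd E i\<close>, the diagonal included.
\<close>
definition closed_nbhd :: "'a set set \<Rightarrow> 'a \<Rightarrow> 'a set" where
  "closed_nbhd E i = {j. i = j \<or> {i, j} \<in> E}"

lemma closed_nbhd_refl [simp]: "i \<in> closed_nbhd E i"
  by (simp add: closed_nbhd_def)

lemma closed_nbhd_sym: "j \<in> closed_nbhd E i \<longleftrightarrow> i \<in> closed_nbhd E j"
  by (auto simp: closed_nbhd_def insert_commute)

lemma pattern_proj_nth: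
  "pattern_proj E A $ i $ j = (if j \<in> closed_nbhd E i then A $ i $ j else 0)"
  by (simp add: pattern_proj_def closed_nbhd_def)

text \<open>
  The first condition on the ordering gives the part of the inclusion that concerns vertices above
  \<open>i\<close>, the second the part that concerns vertices below \<open>i\<close>. The inclusion spares later proofs the
  case distinctions on the order of three vertices, and it is also the form in which a homogeneous
  chordal graph provides the ordering.
\<close>
lemma tpeo_iff_nested:
  "trivially_perfect_elim_ordering E \<longleftrightarrow>
     (\<forall>i j. j \<in> closed_nbhd E i \<and> i \<le> j \<longrightarrow> closed_nbhd E i \<subseteq> closed_nbhd E j)"
proof
  assume tpeo: "trivially_perfect_elim_ordering E"
  then have o1: "{j, k} \<in> E" if "{i, j} \<in> E" "{i, k} \<in> E" "i < j" "j < k" for i j k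
    using that unfolding trivially_perfect_elim_ordering_def by blast
  from tpeo have o2: "{i, k} \<in> E" if "{i, j} \<in> E" "{j, k} \<in> E" "i < j" "j < k" for i j k
    using that unfolding trivially_perfect_elim_ordering_def by blast
  have step: "k \<in> closed_nbhd E j" if "j \<in> closed_nbhd E i" "i \<le> j" "k \<in> closed_nbhd E i" for i j k
  proof -
    consider "i = j" | "i = k" | "i < j" "k < i" | "i < j" "i < k" "k < j" | "i < j" "j = k" | "i < j" "j < k"
      using \<open>i \<le> j\<close> by fastforce
    then show ?thesis
    proof cases
      case 3
      then show ?thesis using that o2[of k i j] by (auto simp: closed_nbhd_def insert_commute)
    next
      case 4
      then show ?thesis using that o1[of i k j] by (auto simp: closed_nbhd_def insert_commute)
    next
      case 6
      then show ?thesis using that o1[of i j k] by (auto simp: closed_nbhd_def)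
    qed (use that in \<open>auto simp: closed_nbhd_sym\<close>)
  qed
  show "\<forall>i j. j \<in> closed_nbhd E i \<and> i \<le> j \<longrightarrow> closed_nbhd E i \<subseteq> closed_nbhd E j"
    by (intro allI impI subsetI) (blast intro: step)
next
  assume nested: "\<forall>i j. j \<in> closed_nbhd E i \<and> i \<le> j \<longrightarrow> closed_nbhd E i \<subseteq> closed_nbhd E j"
  show "trivially_perfect_elim_ordering E"
    unfolding trivially_perfect_elim_ordering_def
  proof (intro conjI allI impI)
    fix i j k assume a: "{i, j} \<in> E \<and> {i, k} \<in> E \<and> i < j \<and> j < k"
    then have "j \<in> closed_nbhd E i \<and> i \<le> j" by (auto simp: closed_nbhd_def)
    then have "closed_nbhd E i \<subseteq> closed_nbhd E j" using nested by blast
    with a have "k \<in> closed_nbhd E j" by (auto simp: closed_nbhd_def)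
    with a show "{j, k} \<in> E" by (auto simp: closed_nbhd_def)
  next
    fix i j k assume a: "{i, j} \<in> E \<and> {j, k} \<in> E \<and> i < j \<and> j < k"
    then have "k \<in> closed_nbhd E j \<and> j \<le> k" by (auto simp: closed_nbhd_def)
    then have "closed_nbhd E j \<subseteq> closed_nbhd E k" using nested by blast
    with a have "i \<in> closed_nbhd E k" by (auto simp: closed_nbhd_def insert_commute)
    with a show "{i, k} \<in> E" by (auto simp: closed_nbhd_def insert_commute)
  qed
qed

lemma tpeo_nested:
  assumes "trivially_perfect_elim_ordering E" "j \<in> closed_nbhd E i" "i \<le> j" "k \<in> closed_nbhd E i"
  shows "k \<in> closed_nbhd E j"
  using assms unfolding tpeo_iff_nested by blast

section \<open>The linear space of upper triangular matrices with the pattern\<close>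

definition upper_pattern :: "'n::{finite,linorder} set set \<Rightarrow> (real^'n::_^'n::_) set" where
  "upper_pattern E = {u. \<forall>i j. u $ i $ j \<noteq> 0 \<longrightarrow> i \<le> j \<and> j \<in> closed_nbhd E i}"

lemma T_plus_iff: "u \<in> T_plus E \<longleftrightarrow> u \<in> upper_pattern E \<and> (\<forall>i. 0 \<le> u $ i $ i)"
  by (force simp: T_plus_def upper_pattern_def closed_nbhd_def not_le)

lemma T_plusplus_iff: "u \<in> T_plusplus E \<longleftrightarrow> u \<in> upper_pattern E \<and> (\<forall>i. 0 < u $ i $ i)"
  by (force simp: T_plusplus_def upper_pattern_def closed_nbhd_def not_le)

lemma upper_patternD:
  "u \<in> upper_pattern E \<Longrightarrow> u $ i $ j \<noteq> 0 \<Longrightarrow> i \<le> j \<and> j \<in> closed_nbhd E i"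
  by (simp add: upper_pattern_def)

lemma subspace_upper_pattern: "subspace (upper_pattern E)"
  by (auto simp: subspace_def upper_pattern_def) (metis add.right_neutral)+

text \<open>
  A nonzero summand \<open>u\<^sub>i\<^sub>k v\<^sub>k\<^sub>j\<close> needs \<open>i \<le> k \<le> j\<close> with \<open>i\<close> in the closed neighbourhood of \<open>k\<close>,
  which is contained in that of \<open>j\<close>.
\<close>
lemma upper_pattern_mult:
  assumes "trivially_perfect_elim_ordering E" "u \<in> upper_pattern E" "v \<in> upper_pattern E"
  shows "u ** v \<in> upper_pattern E"
  unfolding upper_pattern_def
proof (intro CollectI allI impI)
  fix i j assume "(u ** v) $ i $ j \<noteq> 0"
  then have "(\<Sum>k\<in>UNIV. u $ i $ k * v $ k $ j) \<noteq> 0"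
    by (simp add: matrix_matrix_mult_def)
  then obtain k where "u $ i $ k * v $ k $ j \<noteq> 0"
    by (rule sum.not_neutral_contains_not_neutral)
  then have le: "i \<le> k" "k \<le> j" and adj: "k \<in> closed_nbhd E i" "j \<in> closed_nbhd E k"
    using assms(2,3) by (auto dest: upper_patternD)
  have "i \<in> closed_nbhd E j"
    using tpeo_nested[OF assms(1) adj(2) le(2)] adj(1) closed_nbhd_sym[of i E k] by simp
  then show "i \<le> j \<and> j \<in> closed_nbhd E i"
    using le closed_nbhd_sym[of i E j] by simp
qed

lemma upper_pattern_mult_diag:
  assumes "u \<in> upper_pattern E" "v \<in> upper_pattern E"
  shows "(u ** v) $ i $ i = u $ i $ i * v $ i $ i"
proof -
  have "(u ** v) $ i $ i = (\<Sum>k\<in>UNIV. u $ i $ k * v $ k $ i)"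
    by (simp add: matrix_matrix_mult_def)
  also have "\<dots> = (\<Sum>k\<in>{i}. u $ i $ k * v $ k $ i)"
    by (rule sum.mono_neutral_right) (use assms in \<open>auto dest!: upper_patternD dest: antisym\<close>)
  finally show ?thesis by simp
qed

lemma mat_1_T_plusplus: "mat 1 \<in> T_plusplus E"
  by (auto simp: T_plusplus_iff upper_pattern_def mat_def)

lemma det_upper_triangular:
  fixes A :: "real^'n::{finite,linorder}^'n::{finite,linorder}"
  assumes "\<And>i j. j < i \<Longrightarrow> A $ i $ j = 0"
  shows "det A = (\<Prod>i\<in>UNIV. A $ i $ i)"
proof -
  have zero: "(\<Prod>i\<in>UNIV. A $ i $ p i) = 0" if p: "p permutes UNIV" and "p \<noteq> id" for p :: "'n \<Rightarrow> 'n"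
  proof -
    \<comment> \<open>a permutation that never decreases fixes everything: look at the largest point it moves\<close>
    have "\<exists>i. p i < i"
    proof (rule ccontr)
      assume "\<not> (\<exists>i. p i < i)"
      then have ge: "i \<le> p i" for i by (simp add: not_less)
      let ?M = "{i. p i \<noteq> i}"
      have ne: "?M \<noteq> {}" using \<open>p \<noteq> id\<close> by (auto simp: fun_eq_iff)
      then have m: "p (Max ?M) \<noteq> Max ?M" using Max_in[of ?M] by simp
      then have "p (p (Max ?M)) \<noteq> p (Max ?M)"
        using permutes_inj[OF p] by (auto dest: injD)
      then have "p (Max ?M) \<le> Max ?M" by (intro Max_ge) auto
      with m ge show False using antisym by blast
    qed
    then show ?thesis using assms by (force intro!: prod_zero)
  qed
  have "det A = (\<Sum>p\<in>{p. p permutes UNIV}. of_int (sign p) * (\<Prod>i\<in>UNIV. A $ i $ p i))"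
    by (simp add: det_def)
  also have "\<dots> = (\<Sum>p\<in>{id}. of_int (sign p) * (\<Prod>i\<in>UNIV. A $ i $ p i))"
    by (rule sum.mono_neutral_right) (auto simp: permutes_id zero finite_permutations)
  finally show ?thesis by (simp add: sign_id)
qed

lemma T_plusplus_invertible: "u \<in> T_plusplus E \<Longrightarrow> invertible u"
proof -
  assume u: "u \<in> T_plusplus E"
  have "det u = (\<Prod>i\<in>UNIV. u $ i $ i)"
    by (rule det_upper_triangular) (use u in \<open>auto simp: T_plusplus_def\<close>)
  also have "\<dots> \<noteq> 0" using u by (simp add: T_plusplus_def less_imp_neq[THEN not_sym])
  finally show ?thesis by (simp add: invertible_det_nz)
qed

text \<open>
  Left multiplication by \<open>u\<close> is an injective endomorphism of a finite-dimensional space, so it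
  reaches the identity. This yields the sparsity pattern of the inverse without back substitution.
\<close>
lemma T_plusplus_inverse:
  assumes "trivially_perfect_elim_ordering E" and u: "u \<in> T_plusplus E"
  obtains v where "v \<in> T_plusplus E" "v ** u = mat 1" "u ** v = mat 1"
proof -
  let ?f = "\<lambda>v. u ** v"
  have lin: "linear ?f"
    by (rule linearI) (auto simp: vec_eq_iff matrix_matrix_mult_def
        sum_distrib_left sum.distrib algebra_simps)
  from T_plusplus_invertible[OF u] obtain u' where u': "u' ** u = mat 1"
    by (auto simp: invertible_left_inverse)
  have "inj ?f"
    by (rule inj_on_inverseI[where g="\<lambda>w. u' ** w"]) (simp add: matrix_mul_assoc u')
  then have "dim (?f ` upper_pattern E) = dim (upper_pattern E)"
    using lin by (intro dim_image_eq) (auto intro: inj_on_subset)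
  moreover have "?f ` upper_pattern E \<subseteq> upper_pattern E"
    using upper_pattern_mult assms by (auto simp: T_plusplus_iff)
  ultimately have "?f ` upper_pattern E = upper_pattern E"
    by (intro subspace_dim_equal) (auto simp: subspace_upper_pattern linear_subspace_image lin)
  moreover have "mat 1 \<in> upper_pattern E" using mat_1_T_plusplus T_plusplus_iff by blast
  ultimately obtain v where v: "v \<in> upper_pattern E" "u ** v = mat 1" by (metis imageE)
  have "0 < v $ i $ i" for i
  proof -
    have "u $ i $ i * v $ i $ i = 1"
      using upper_pattern_mult_diag[of u E v i] v u by (simp add: T_plusplus_iff mat_def)
    moreover have "0 < u $ i $ i" using u by (simp add: T_plusplus_iff)
    ultimately show ?thesis by (metis zero_less_mult_pos zero_less_one)
  qed
  then show ?thesis using that v matrix_left_right_inverse by (auto simp: T_plusplus_iff)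
qed

lemma T_plusplus_mult:
  assumes "trivially_perfect_elim_ordering E" "u \<in> T_plusplus E" "v \<in> T_plusplus E"
  shows "u ** v \<in> T_plusplus E"
  using assms upper_pattern_mult[of E u v] upper_pattern_mult_diag[of u E v]
  by (simp add: T_plusplus_iff)

section \<open>The projected congruence action\<close>

lemma congruence_nth:
  fixes u x :: "real^'n^'n"
  shows "(u ** x ** transpose u) $ i $ j = (\<Sum>l\<in>UNIV. \<Sum>k\<in>UNIV. u $ i $ k * x $ k $ l * u $ j $ l)"
  by (simp add: matrix_matrix_mult_def transpose_def sum_distrib_right)

text \<open>
  A term \<open>u\<^sub>i\<^sub>k w\<^sub>k\<^sub>l u\<^sub>j\<^sub>l\<close> with \<open>i\<close>, \<open>j\<close> adjacent survives only if \<open>k\<close> is \<open>i\<close> or a larger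
  neighbour of it, and \<open>l\<close> is \<open>j\<close> or a larger neighbour of it; applying nestedness twice, \<open>k\<close> and \<open>l\<close> are adjacent. So the off-pattern entries of \<open>w\<close> are never
  seen, and congruences by \<^const>\<open>upper_pattern\<close> matrices descend to projected matrices.
\<close>
lemma pattern_proj_congruence:
  assumes tpeo: "trivially_perfect_elim_ordering E" and u: "u \<in> upper_pattern E"
  shows "pattern_proj E (u ** pattern_proj E w ** transpose u) = pattern_proj E (u ** w ** transpose u)"
proof -
  have "u $ i $ k * pattern_proj E w $ k $ l * u $ j $ l = u $ i $ k * w $ k $ l * u $ j $ l"
    if ij: "j \<in> closed_nbhd E i" for i j k l
  proof (cases "u $ i $ k = 0 \<or> u $ j $ l = 0")
    case False
    with u have "i \<le> k" "k \<in> closed_nbhd E i" "j \<le> l" "l \<in> closed_nbhd E j"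
      by (auto dest: upper_patternD)
    with ij have "l \<in> closed_nbhd E k"
      using tpeo_nested[OF tpeo, of k i j] tpeo_nested[OF tpeo, of l j k]
        closed_nbhd_sym[of k E j] closed_nbhd_sym[of l E k] by simp
    then show ?thesis by (simp add: pattern_proj_nth)
  qed auto
  then have "(u ** pattern_proj E w ** transpose u) $ i $ j = (u ** w ** transpose u) $ i $ j"
    if "j \<in> closed_nbhd E i" for i j
    unfolding congruence_nth using that by (intro sum.cong) auto
  then show ?thesis by (simp add: vec_eq_iff pattern_proj_nth)
qed

lemma pattern_proj_pattern_space: "x \<in> pattern_space E \<Longrightarrow> pattern_proj E x = x"
  by (auto simp: pattern_space_def vec_eq_iff pattern_proj_def)

lemma transpose_pattern_proj: "transpose (pattern_proj E A) = pattern_proj E (transpose A)"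
  by (auto simp: vec_eq_iff pattern_proj_nth transpose_def closed_nbhd_sym)

lemma pattern_proj_in_space: "transpose A = A \<Longrightarrow> pattern_proj E A \<in> pattern_space E"
  by (simp add: pattern_space_def transpose_pattern_proj) (simp add: pattern_proj_def)

lemma transpose_congruence:
  fixes u b :: "real^'n^'n"
  shows "transpose b = b \<Longrightarrow> transpose (u ** b ** transpose u) = u ** b ** transpose u"
  by (simp add: matrix_transpose_mul matrix_mul_assoc)

lemma pattern_proj_add: "pattern_proj E (A + B) = pattern_proj E A + pattern_proj E B"
  by (simp add: vec_eq_iff pattern_proj_def)

lemma pattern_proj_diff: "pattern_proj E (A - B) = pattern_proj E A - pattern_proj E B"
  by (simp add: vec_eq_iff pattern_proj_def)

lemma pattern_proj_scaleR: "pattern_proj E (c *\<^sub>R A) = c *\<^sub>R pattern_proj E A"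
  by (simp add: vec_eq_iff pattern_proj_def)

lemma pattern_proj_mult_left:
  assumes tpeo: "trivially_perfect_elim_ordering E" and u: "u \<in> upper_pattern E"
  shows "pattern_proj E (u ** pattern_proj E w) = pattern_proj E (u ** w)"
proof -
  have "u $ i $ k * pattern_proj E w $ k $ j = u $ i $ k * w $ k $ j"
    if ij: "j \<in> closed_nbhd E i" for i j k
  proof (cases "u $ i $ k = 0")
    case False
    with u have "i \<le> k" "k \<in> closed_nbhd E i" by (auto dest: upper_patternD)
    with ij have "j \<in> closed_nbhd E k"
      using tpeo_nested[OF tpeo] by blast
    then show ?thesis by (simp add: pattern_proj_nth)
  qed auto
  then have "(u ** pattern_proj E w) $ i $ j = (u ** w) $ i $ j" if "j \<in> closed_nbhd E i" for i j
    using that by (auto simp: matrix_matrix_mult_def intro!: sum.cong)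
  then show ?thesis by (simp add: vec_eq_iff pattern_proj_nth)
qed

text \<open>
  All inner projections may be dropped: in \<open>u (b u\<^sup>*)\<close> and \<open>u (u b)\<close> by
  \<open>pattern_proj_mult_left\<close>, and in \<open>u u\<close> because it has the pattern. The last two terms of
  \<^const>\<open>Q_map\<close> then cancel by associativity, and what remains is already symmetric.
\<close>
lemma Q_map_eq_congruence:
  assumes tpeo: "trivially_perfect_elim_ordering E" and u: "u \<in> upper_pattern E"
    and b: "b \<in> pattern_space E"
  shows "Q_map E u b = pattern_proj E (u ** b ** transpose u)"
proof -
  have "pattern_proj E (u ** u) = u ** u"
    using upper_pattern_mult[OF tpeo u u]
    by (auto simp: vec_eq_iff pattern_proj_nth dest: upper_patternD)
  then have c: "star E u (star E b (transpose u)) + star E u (star E u b) - star E (star E u u) b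
      = pattern_proj E (u ** b ** transpose u)"
    by (simp add: star_def pattern_proj_mult_left[OF tpeo u] matrix_mul_assoc)
  have "transpose b = b" using b by (simp add: pattern_space_def)
  then show ?thesis
    unfolding Q_map_def Let_def c
    by (simp add: transpose_pattern_proj transpose_congruence flip: scaleR_2)
qed

text \<open>
  The composition law makes \<^const>\<open>T_plusplus\<close> act as a group on the pattern space.
\<close>
lemma Q_map_comp:
  assumes "trivially_perfect_elim_ordering E" "u \<in> T_plusplus E" "v \<in> T_plusplus E"
    "b \<in> pattern_space E"
  shows "Q_map E u (Q_map E v b) = Q_map E (u ** v) b"
proof -
  have "transpose b = b" using assms(4) by (simp add: pattern_space_def)
  then have "Q_map E v b \<in> pattern_space E"
    using assms by (simp add: Q_map_eq_congruence T_plusplus_iff pattern_proj_in_space transpose_congruence)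
  then show ?thesis
    using assms upper_pattern_mult[of E u v]
    by (simp add: Q_map_eq_congruence T_plusplus_iff pattern_proj_congruence matrix_transpose_mul matrix_mul_assoc)
qed

section \<open>Positive semidefinite matrices\<close>

lemma psd_congruence:
  fixes u w :: "real^'n^'n"
  assumes "psd w"
  shows "psd (u ** w ** transpose u)"
proof -
  have "v \<bullet> ((u ** w ** transpose u) *v v) = (v v* u) \<bullet> (w *v (v v* u))" for v
    by (simp add: dot_lmul_matrix flip: matrix_vector_mul_assoc)
  then show ?thesis using assms by (simp add: psd_def transpose_congruence)
qed

lemma psd_mat_1: "psd (mat 1)"
  by (simp add: psd_def)

lemma psd_mult_transpose: "psd (t ** transpose t)" for t :: "real^'n^'n"
  using psd_congruence[OF psd_mat_1, of t] by simp

lemma psd_add: "psd A \<Longrightarrow> psd B \<Longrightarrow> psd (A + B)"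
  by (auto simp: psd_def transpose_def vec_eq_iff matrix_vector_mult_add_rdistrib inner_add_right)

lemma psd_scaleR: "psd A \<Longrightarrow> 0 \<le> c \<Longrightarrow> psd (c *\<^sub>R A)"
  by (simp add: psd_def transpose_scalar flip: scaleR_matrix_vector_assoc)

lemma psd_sym:
  assumes "psd w"
  shows "w $ i $ j = w $ j $ i"
proof -
  have "transpose w $ i $ j = w $ i $ j" using assms by (simp add: psd_def)
  then show ?thesis by (simp add: transpose_def)
qed

lemma matrix_axis_nth: "(w *v axis i 1) $ j = w $ j $ i" for w :: "real^'n^'m"
  by (simp add: matrix_vector_mult_basis column_def)

lemma quadratic_form_axis:
  fixes w :: "real^'n^'n"
  assumes "transpose w = w"
  shows "(v + s *\<^sub>R axis j 1) \<bullet> (w *v (v + s *\<^sub>R axis j 1)) =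
    v \<bullet> (w *v v) + 2 * s * (w *v v) $ j + s\<^sup>2 * w $ j $ j"
proof -
  have "v \<bullet> (w *v axis j 1) = (transpose w *v v) \<bullet> axis j 1"
    by (simp add: dot_lmul_matrix)
  then have "v \<bullet> (w *v axis j 1) = (w *v v) $ j"
    unfolding assms by (simp add: inner_axis)
  then show ?thesis
    by (simp add: matrix_vector_right_distrib matrix_vector_mult_scaleR inner_add_left
        inner_add_right inner_axis' matrix_axis_nth power2_eq_square algebra_simps)
qed

lemma psd_diag_nonneg:
  assumes "psd w"
  shows "0 \<le> w $ j $ j"
proof -
  have "0 \<le> axis j 1 \<bullet> (w *v axis j 1)" using assms by (simp add: psd_def)
  then show ?thesis by (simp add: inner_axis' matrix_axis_nth)
qed

text \<open>
  If \<open>w $ j $ i\<close> were nonzero, the quadratic form would be affine and nonconstant along the line through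
  \<open>axis i 1\<close> in direction \<open>axis j 1\<close>, hence unbounded below.
\<close>
lemma psd_zero_diag:
  assumes "psd w" "w $ j $ j = 0"
  shows "w $ j $ i = 0" and "w $ i $ j = 0"
proof -
  have nonneg: "0 \<le> w $ i $ i + 2 * s * w $ j $ i" for s
  proof -
    let ?v = "axis i 1 + s *\<^sub>R axis j 1"
    have "0 \<le> ?v \<bullet> (w *v ?v)" using assms(1) by (simp add: psd_def)
    also have "\<dots> = w $ i $ i + 2 * s * w $ j $ i"
      using assms by (subst quadratic_form_axis) (simp_all add: psd_def inner_axis' matrix_axis_nth)
    finally show ?thesis .
  qed
  show *: "w $ j $ i = 0"
  proof (rule ccontr)
    assume "w $ j $ i \<noteq> 0"
    then show False using nonneg[of "- (w $ i $ i + 1) / (2 * w $ j $ i)"] by (simp add: field_simps)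
  qed
  with psd_sym[OF assms(1)] show "w $ i $ j = 0" by simp
qed

text \<open>
  The quadratic form of the complement at \<open>v\<close> is the value of the form of \<open>w\<close> at
  \<open>v + s *\<^sub>R axis j 1\<close>, for the \<open>s\<close> that minimizes it.
\<close>
lemma psd_Schur_complement:
  assumes "psd w" "0 < w $ j $ j"
  shows "psd (\<chi> i k. w $ i $ k - w $ i $ j * w $ k $ j / w $ j $ j)" (is "psd ?s")
proof -
  have "0 \<le> v \<bullet> (?s *v v)" for v
  proof -
    let ?a = "(w *v v) $ j"
    have a: "?a = (\<Sum>k\<in>UNIV. w $ k $ j * v $ k)"
      using psd_sym[OF assms(1)] by (simp add: matrix_vector_mult_def)
    have "?s *v v = w *v v - (?a / w $ j $ j) *\<^sub>R column j w"
    proof -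
      have "(?s *v v) $ i = (w *v v) $ i - (?a / w $ j $ j) * w $ i $ j" for i
        unfolding a
        by (simp add: matrix_vector_mult_def algebra_simps sum_distrib_left
            sum_divide_distrib flip: sum_subtractf)
      then show ?thesis by (simp add: vec_eq_iff column_def)
    qed
    moreover have "v \<bullet> column j w = ?a"
      unfolding a by (simp add: inner_vec_def column_def mult.commute)
    ultimately have "v \<bullet> (?s *v v) = v \<bullet> (w *v v) - ?a\<^sup>2 / w $ j $ j"
      by (simp add: inner_diff_right power2_eq_square)
    also have "\<dots> = v \<bullet> (w *v v) + 2 * (- ?a / w $ j $ j) * ?a + (- ?a / w $ j $ j)\<^sup>2 * w $ j $ j"
      using assms(2) by (simp add: power2_eq_square field_simps)
    also have "\<dots> \<ge> 0"
      using assms(1) unfolding psd_def by (subst quadratic_form_axis[symmetric]) auto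
    finally show ?thesis .
  qed
  moreover have "transpose ?s = ?s"
    using psd_sym[OF assms(1)] by (simp add: transpose_def vec_eq_iff mult.commute)
  ultimately show ?thesis by (simp add: psd_def)
qed

lemma transpose_e_mat [simp]: "transpose (e_mat I) = e_mat I"
  by (auto simp: e_mat_def transpose_def vec_eq_iff)

lemma mult_e_mat_nth: "(A ** e_mat I) $ i $ j = (if j \<in> I then 0 else A $ i $ j)"
proof -
  have "A $ i $ k * e_mat I $ k $ j = (if k = j then if j \<in> I then 0 else A $ i $ j else 0)" for k
    by (simp add: e_mat_def)
  then show ?thesis by (simp add: matrix_matrix_mult_def)
qed

lemma e_mat_mult_nth: "(e_mat I ** A) $ i $ j = (if i \<in> I then 0 else A $ i $ j)"
proof -
  have "e_mat I $ i $ k * A $ k $ j = (if k = i then if i \<in> I then 0 else A $ i $ j else 0)" for k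
    by (simp add: e_mat_def)
  then show ?thesis by (simp add: matrix_matrix_mult_def)
qed

lemma e_mat_idem: "e_mat I ** e_mat I = e_mat I"
  by (simp add: vec_eq_iff mult_e_mat_nth) (simp add: e_mat_def)

text \<open>
  Deleting the off-diagonal blocks adds the compressions to \<open>I\<close> and to its complement.
\<close>
lemma psd_blocks:
  assumes "psd w"
  shows "psd (\<chi> i j. if i \<in> I \<longleftrightarrow> j \<in> I then w $ i $ j else 0)"
proof -
  have "psd (e_mat I ** w ** transpose (e_mat I) + e_mat (- I) ** w ** transpose (e_mat (- I)))"
    using assms by (intro psd_add psd_congruence)
  also have "e_mat I ** w ** transpose (e_mat I) + e_mat (- I) ** w ** transpose (e_mat (- I)) =
      (\<chi> i j. if i \<in> I \<longleftrightarrow> j \<in> I then w $ i $ j else 0)"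
    by (auto simp: vec_eq_iff mult_e_mat_nth e_mat_mult_nth)
  finally show ?thesis .
qed

section \<open>Triangular factorization\<close>

text \<open>
  Cholesky elimination from the largest index downwards, where \<open>U\<close> is the set of indices already
  eliminated. Let \<open>j\<close> be the largest remaining one. Nestedness makes the neighbourhood of \<open>j\<close> a union
  of connected components of the graph on the remaining vertices, so entries between it and the
  other vertices are off the pattern and can be erased by \<open>psd_blocks\<close>. After that, the \<open>j\<close>-th
  column is supported on the neighbourhood of \<open>j\<close> and serves, suitably scaled, as a column of \<open>t\<close>; the
  Schur complement is left. If the pivot is zero, then so is its column, and \<open>t\<close> gets a zero column,
  which is what properness asks for.
\<close>
lemma psd_triangular_factor_above:
  assumes tpeo: "trivially_perfect_elim_ordering E"
    and "psd w"
    and up: "\<And>i k. i \<in> U \<Longrightarrow> i \<le> k \<Longrightarrow> k \<in> U"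
    and rows: "\<And>i k. i \<in> U \<Longrightarrow> w $ i $ k = 0"
  shows "\<exists>t\<in>T_plus E. proper_matrix t \<and> (\<forall>i\<in>U. column i t = 0) \<and>
    pattern_proj E (t ** transpose t) = pattern_proj E w"
  using \<open>psd w\<close> up rows
proof (induction "card (- U)" arbitrary: U w)
  case 0
  then have "U = UNIV" by auto
  with 0 have "w = 0" by (simp add: vec_eq_iff)
  then show ?case
    by (intro bexI[of _ 0]) (auto simp: T_plus_def proper_matrix_def column_def vec_eq_iff
        matrix_matrix_mult_def pattern_proj_nth)
next
  case (Suc n)
  define j where "j = Max (- U)"
  have "- U \<noteq> {}" using Suc(2) by auto
  then have j: "j \<notin> U" and max: "\<And>i. i \<notin> U \<Longrightarrow> i \<le> j"
    unfolding j_def using Max_in[of "- U"] by auto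
  have card: "n = card (- insert j U)"
    using Suc(2) j by (simp add: Compl_insert)
  have up': "k \<in> insert j U" if "i \<in> insert j U" "i \<le> k" for i k
    using that Suc(4) max[of k] by (cases "k \<in> U") auto
  define N where "N = closed_nbhd E j"
  define w2 where "w2 = (\<chi> i k. if i \<in> N \<longleftrightarrow> k \<in> N then w $ i $ k else 0)"
  have psd2: "psd w2" unfolding w2_def by (rule psd_blocks) fact
  have rows2: "w2 $ i $ k = 0" if "i \<in> U" for i k
    using that Suc(5) by (simp add: w2_def)
  have proj2: "pattern_proj E w = pattern_proj E w2"
  proof -
    have *: "w $ i $ k = 0" if adj: "k \<in> closed_nbhd E i" and N: "i \<in> N" "k \<notin> N" for i k
    proof (cases "i \<in> U")
      case False
      then have "i \<le> j" by (rule max)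
      then have "k \<in> N"
        using tpeo_nested[OF tpeo, of j i k] adj N closed_nbhd_sym[of j E i] unfolding N_def by simp
      with N show ?thesis by simp
    qed (simp add: Suc(5))
    have "w $ i $ k = 0" if "k \<in> closed_nbhd E i" "(i \<in> N) \<noteq> (k \<in> N)" for i k
      using that *[of k i] *[of i k] psd_sym[OF Suc(3), of i k] closed_nbhd_sym[of k E i] by auto
    then show ?thesis by (auto simp: vec_eq_iff pattern_proj_nth w2_def)
  qed
  show ?case
  proof (cases "w2 $ j $ j = 0")
    case True
    have zero: "w2 $ i $ k = 0" if "i \<in> insert j U" for i k
      using that rows2 psd_zero_diag(1)[OF psd2 True] by blast
    have "\<exists>t\<in>T_plus E. proper_matrix t \<and> (\<forall>i\<in>insert j U. column i t = 0) \<and>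
        pattern_proj E (t ** transpose t) = pattern_proj E w2"
      by (rule Suc(1)[OF card psd2]) (erule (1) up', erule zero)
    then show ?thesis unfolding proj2 by auto
  next
    case False
    with psd_diag_nonneg[OF psd2, of j] have pos: "0 < w2 $ j $ j" by simp
    define w3 where "w3 = (\<chi> i k. w2 $ i $ k - w2 $ i $ j * w2 $ k $ j / w2 $ j $ j)"
    have psd3: "psd w3" unfolding w3_def using psd2 pos by (rule psd_Schur_complement)
    have zero: "w3 $ i $ k = 0" if "i \<in> insert j U" for i k
      using that rows2 pos psd_sym[OF psd2, of j k] by (auto simp: w3_def)
    have "\<exists>t\<in>T_plus E. proper_matrix t \<and> (\<forall>i\<in>insert j U. column i t = 0) \<and>
        pattern_proj E (t ** transpose t) = pattern_proj E w3"
      by (rule Suc(1)[OF card psd3]) (erule (1) up', erule zero)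
    then obtain s where s: "s \<in> T_plus E" "proper_matrix s"
      and s0: "\<And>i. i \<in> insert j U \<Longrightarrow> column i s = 0"
      and sw: "pattern_proj E (s ** transpose s) = pattern_proj E w3" by auto
    have s0': "s $ i $ k = 0" if "k \<in> insert j U" for i k
      using s0[OF that] by (simp add: column_def vec_eq_iff)
    define t where "t = (\<chi> i k. if k = j then w2 $ i $ j / sqrt (w2 $ j $ j) else s $ i $ k)"
    have supp: "i \<le> j \<and> j \<in> closed_nbhd E i" if "w2 $ i $ j \<noteq> 0" for i
    proof -
      have "i \<notin> U" using that rows2 by blast
      moreover have "i \<in> N"
        using that by (simp add: w2_def N_def split: if_splits)
      ultimately have "i \<notin> U" "i \<in> N" by blast+
      then show ?thesis using max closed_nbhd_sym[of j E i] by (simp add: N_def)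
    qed
    have "t \<in> upper_pattern E"
      using s(1) supp unfolding T_plus_iff upper_pattern_def t_def by auto
    moreover have "0 \<le> t $ i $ i" for i
      using s(1) pos by (simp add: T_plus_def t_def)
    ultimately have "t \<in> T_plus E" by (simp add: T_plus_iff)
    moreover have "proper_matrix t"
      using s(2) pos by (auto simp: proper_matrix_def column_def t_def vec_eq_iff)
    moreover have "column i t = 0" if "i \<in> U" for i
      using that j s0' by (auto simp: column_def t_def vec_eq_iff)
    moreover have "t ** transpose t = s ** transpose s + (w2 - w3)"
    proof -
      have "(\<Sum>l\<in>UNIV. t $ i $ l * t $ k $ l) =
          (\<Sum>l\<in>UNIV. s $ i $ l * s $ k $ l) + w2 $ i $ j * w2 $ k $ j / w2 $ j $ j" for i k
      proof -
        have "(\<Sum>l\<in>UNIV. t $ i $ l * t $ k $ l) =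
            t $ i $ j * t $ k $ j + (\<Sum>l\<in>UNIV-{j}. t $ i $ l * t $ k $ l)"
          by (simp add: sum.remove)
        also have "t $ i $ j * t $ k $ j = w2 $ i $ j * w2 $ k $ j / w2 $ j $ j"
          using pos by (simp add: t_def)
        also have "(\<Sum>l\<in>UNIV-{j}. t $ i $ l * t $ k $ l) = (\<Sum>l\<in>UNIV-{j}. s $ i $ l * s $ k $ l)"
          by (rule sum.cong) (auto simp: t_def)
        also have "\<dots> = (\<Sum>l\<in>UNIV. s $ i $ l * s $ k $ l)"
          by (simp add: sum.remove[of UNIV j] s0')
        finally show ?thesis by simp
      qed
      then show ?thesis
        by (simp add: vec_eq_iff matrix_matrix_mult_def transpose_def w3_def)
    qed
    then have "pattern_proj E (t ** transpose t) = pattern_proj E w"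
      by (simp add: pattern_proj_add pattern_proj_diff sw proj2)
    ultimately show ?thesis by blast
  qed
qed

lemma pattern_cone_triangular_factor:
  assumes "trivially_perfect_elim_ordering E" "x \<in> pattern_cone E"
  obtains t where "t \<in> T_plus E" "proper_matrix t" "x = pattern_proj E (t ** transpose t)"
proof -
  from assms(2) obtain w where "psd w" "x = pattern_proj E w" by (auto simp: pattern_cone_def)
  with psd_triangular_factor_above[OF assms(1), of w "{}"] show ?thesis using that by auto
qed

lemma mult_transpose_nth:
  "(t ** transpose t) $ i $ j = (\<Sum>k\<in>UNIV. t $ i $ k * t $ j $ k)" for t :: "real^'n^'n"
  by (simp add: matrix_matrix_mult_def transpose_def)

text \<open>
  In the last column \<open>j\<close> where the factors differ, comparing the entries \<open>(i, j)\<close> of the products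
  leaves only \<open>t\<^sub>i\<^sub>j t\<^sub>j\<^sub>j\<close>. So the diagonal entries agree; if they are positive, the column is determined
  by division, and if they vanish, properness makes both columns zero.
\<close>
lemma triangular_factor_unique:
  assumes t: "t \<in> T_plus E" "proper_matrix t" and s: "s \<in> T_plus E" "proper_matrix s"
    and eq: "pattern_proj E (t ** transpose t) = pattern_proj E (s ** transpose s)"
  shows "t = s"
proof (rule ccontr)
  assume "t \<noteq> s"
  then obtain i0 k0 where "t $ i0 $ k0 \<noteq> s $ i0 $ k0" by (auto simp: vec_eq_iff)
  define D where "D = {k. \<exists>i. t $ i $ k \<noteq> s $ i $ k}"
  define j where "j = Max D"
  have "D \<noteq> {}" unfolding D_def using \<open>t $ i0 $ k0 \<noteq> s $ i0 $ k0\<close> by blast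
  then have jD: "j \<in> D" unfolding j_def by (intro Max_in) auto
  have above: "t $ i $ k = s $ i $ k" if "j < k" for i k
    using that Max_ge[of D k] unfolding j_def[symmetric] by (force simp: D_def)
  have supp: "i \<le> j" "j \<in> closed_nbhd E i" if "t $ i $ j \<noteq> 0 \<or> s $ i $ j \<noteq> 0" for i
    using that t(1) s(1) by (auto simp: T_plus_iff dest: upper_patternD)
  have key: "t $ i $ j * t $ j $ j = s $ i $ j * s $ j $ j" if "j \<in> closed_nbhd E i" for i
  proof -
    have low: "t $ j $ k = 0" "s $ j $ k = 0" if "k < j" for k
      using that t(1) s(1) by (auto simp: T_plus_def)
    have "pattern_proj E (t ** transpose t) $ i $ j = pattern_proj E (s ** transpose s) $ i $ j"
      using eq by simp
    then have "(\<Sum>k\<in>UNIV. t $ i $ k * t $ j $ k) = (\<Sum>k\<in>UNIV. s $ i $ k * s $ j $ k)"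
      using that by (simp add: pattern_proj_nth mult_transpose_nth)
    moreover have "(\<Sum>k\<in>UNIV-{j}. t $ i $ k * t $ j $ k) = (\<Sum>k\<in>UNIV-{j}. s $ i $ k * s $ j $ k)"
    proof (rule sum.cong)
      fix k assume "k \<in> UNIV - {j}"
      then have "k < j \<or> j < k" by auto
      then show "t $ i $ k * t $ j $ k = s $ i $ k * s $ j $ k" using low above by auto
    qed simp
    ultimately show ?thesis by (simp add: sum.remove[of UNIV j])
  qed
  have nonneg: "0 \<le> t $ j $ j" "0 \<le> s $ j $ j" using t(1) s(1) by (auto simp: T_plus_def)
  have diag: "t $ j $ j = s $ j $ j"
    using key[of j] nonneg by (simp flip: power2_eq_square)
  have "t $ i $ j = s $ i $ j" for i
  proof (cases "t $ j $ j = 0")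
    case True
    then have "column j t = 0" "column j s = 0"
      using diag t(2) s(2) by (auto simp: proper_matrix_def)
    then show ?thesis by (simp add: column_def vec_eq_iff)
  next
    case False
    show ?thesis
    proof (cases "j \<in> closed_nbhd E i")
      case True
      from key[OF True] False diag show ?thesis by simp
    next
      case False
      with supp(2)[of i] have "t $ i $ j = 0" "s $ i $ j = 0" by auto
      then show ?thesis by simp
    qed
  qed
  with jD show False by (simp add: D_def)
qed

text \<open>
  Filling the zero diagonal positions of \<open>t\<close> with ones gives an invertible \<open>d\<close> with
  \<open>t = d ** e_mat (zero_diag t)\<close>, since a proper \<open>t\<close> has no other entries in those columns. The inverse
  of \<open>d\<close> is the required matrix.
\<close>
lemma triangular_factor_normalizer:
  assumes tpeo: "trivially_perfect_elim_ordering E" and t: "t \<in> T_plus E" "proper_matrix t"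
  obtains u where "u \<in> T_plusplus E" "u ** t = e_mat (zero_diag t)"
proof -
  define d where "d = t + e_mat (- zero_diag t)"
  have "d \<in> T_plusplus E"
    unfolding T_plusplus_iff
  proof
    show "d \<in> upper_pattern E"
      unfolding d_def using t(1)
      by (intro subspace_add[OF subspace_upper_pattern]) (auto simp: T_plus_iff upper_pattern_def e_mat_def)
    show "\<forall>i. 0 < d $ i $ i"
      using t(1) by (auto simp: d_def e_mat_def zero_diag_def T_plus_def less_le)
  qed
  from T_plusplus_inverse[OF tpeo this] obtain u where u: "u \<in> T_plusplus E" "u ** d = mat 1"
    by metis
  have "t = d ** e_mat (zero_diag t)"
  proof -
    have "(d ** e_mat (zero_diag t)) $ i $ j = t $ i $ j" for i j
    proof -
      have "(d ** e_mat (zero_diag t)) $ i $ j = (if t $ j $ j = 0 then 0 else d $ i $ j)"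
        by (simp add: mult_e_mat_nth zero_diag_def)
      also have "\<dots> = t $ i $ j"
        using t(2) by (auto simp: d_def e_mat_def zero_diag_def proper_matrix_def column_def vec_eq_iff)
      finally show ?thesis .
    qed
    then show ?thesis by (simp add: vec_eq_iff)
  qed
  then have "u ** t = u ** d ** e_mat (zero_diag t)" by (metis matrix_mul_assoc)
  with u show ?thesis using that by simp
qed

section \<open>Isomorphisms and faces of cones\<close>

text \<open>
  Linear isomorphism of two cones with their ambient spaces. Both automorphisms of one cone and the
  change of the vertex labels, which changes the ambient space, are of this kind.
\<close>
definition cone_iso :: "'a::real_vector set \<Rightarrow> 'a set \<Rightarrow> 'b::real_vector set \<Rightarrow> 'b set \<Rightarrow> ('a \<Rightarrow> 'b) \<Rightarrow> bool" where
  "cone_iso S K S' K' f \<longleftrightarrow> bij_betw f S S' \<and>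
     (\<forall>x\<in>S. \<forall>y\<in>S. f (x + y) = f x + f y) \<and> (\<forall>c. \<forall>x\<in>S. f (c *\<^sub>R x) = c *\<^sub>R f x) \<and> f ` K = K'"

lemma cone_automorphism_iff_cone_iso: "cone_automorphism S K Q \<longleftrightarrow> cone_iso S K S K Q"
  by (auto simp: cone_automorphism_def cone_iso_def linear_endo_def bij_betw_def)

lemma cone_iso_comp:
  assumes "cone_iso S K S' K' f" "cone_iso S' K' S'' K'' g"
  shows "cone_iso S K S'' K'' (g \<circ> f)"
proof -
  have "f x \<in> S'" if "x \<in> S" for x using assms(1) that by (auto simp: cone_iso_def bij_betw_def)
  then show ?thesis
    using assms unfolding cone_iso_def by (auto intro: bij_betw_trans simp: image_comp)
qed

lemma cone_iso_inv:
  assumes f: "cone_iso S K S' K' f" and S: "subspace S" and K: "K \<subseteq> S"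
  shows "cone_iso S' K' S K (inv_into S f)"
proof -
  let ?g = "inv_into S f"
  have bij: "bij_betw f S S'" using f by (simp add: cone_iso_def)
  then have gf: "?g (f x) = x" if "x \<in> S" for x using that by (simp add: bij_betw_def)
  have gS: "?g z \<in> S" and fg: "f (?g z) = z" if "z \<in> S'" for z
    using that bij by (auto simp: bij_betw_def intro: inv_into_into f_inv_into_f)
  have "?g (x + y) = ?g x + ?g y" if "x \<in> S'" "y \<in> S'" for x y
  proof -
    have "f (?g x + ?g y) = x + y" using f that by (simp add: cone_iso_def gS fg)
    moreover have "?g x + ?g y \<in> S" using S that gS by (simp add: subspace_add)
    ultimately show ?thesis using gf by metis
  qed
  moreover have "?g (c *\<^sub>R x) = c *\<^sub>R ?g x" if "x \<in> S'" for c x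
  proof -
    have "f (c *\<^sub>R ?g x) = c *\<^sub>R x" using f that by (simp add: cone_iso_def gS fg)
    moreover have "c *\<^sub>R ?g x \<in> S" using S that gS by (simp add: subspace_scale)
    ultimately show ?thesis using gf by metis
  qed
  moreover have "?g ` K' = K"
  proof -
    have "K' = f ` K" using f by (simp add: cone_iso_def)
    then have "?g ` K' = (\<lambda>x. ?g (f x)) ` K" by (simp add: image_image)
    also have "\<dots> = (\<lambda>x. x) ` K" by (rule image_cong) (use K gf in auto)
    finally show ?thesis by simp
  qed
  ultimately show ?thesis using bij by (simp add: cone_iso_def bij_betw_inv_into)
qed

text \<open>
  Conjugate the projection by the isomorphism.
\<close>
lemma projectionally_exposed_cone_iso:
  assumes f: "cone_iso S K S' K' f" and S: "subspace S" and K: "K \<subseteq> S" and F: "F \<subseteq> S"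
    and exposed: "projectionally_exposed S' K' (f ` F)"
  shows "projectionally_exposed S K F"
proof -
  from exposed obtain P where P: "linear_endo S' P" "\<And>z. z \<in> S' \<Longrightarrow> P (P z) = P z" "P ` K' = f ` F"
    by (auto simp: projectionally_exposed_def)
  define g where "g = inv_into S f"
  have g: "cone_iso S' K' S K g" unfolding g_def by (rule cone_iso_inv[OF f S K])
  have bij: "bij_betw f S S'" using f by (simp add: cone_iso_def)
  have gf: "g (f x) = x" if "x \<in> S" for x using that bij by (simp add: bij_betw_def g_def)
  have gS: "g z \<in> S" and fg: "f (g z) = z" if "z \<in> S'" for z
    using that bij by (auto simp: bij_betw_def g_def intro: inv_into_into f_inv_into_f)
  have fS: "f x \<in> S'" if "x \<in> S" for x using that bij by (auto simp: bij_betw_def)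
  have PS: "P z \<in> S'" if "z \<in> S'" for z using that P(1) by (auto simp: linear_endo_def)
  have "linear_endo S (\<lambda>x. g (P (f x)))"
    using f g P(1) by (auto simp: linear_endo_def cone_iso_def fS PS gS)
  moreover have "g (P (f (g (P (f x))))) = g (P (f x))" if "x \<in> S" for x
    using that by (simp add: fS PS fg P(2))
  moreover have "(\<lambda>x. g (P (f x))) ` K = F"
  proof -
    have "(\<lambda>x. g (P (f x))) ` K = g ` P ` f ` K" by (simp add: image_image)
    also have "\<dots> = g ` f ` F" using f P(3) by (simp add: cone_iso_def)
    also have "\<dots> = (\<lambda>x. x) ` F" unfolding image_image by (rule image_cong) (use F gf in auto)
    finally show ?thesis by simp
  qed
  ultimately show ?thesis by (auto simp: projectionally_exposed_def)
qed

lemma cone_face_cone_iso: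
  assumes f: "cone_iso S K S' K' f" and S: "subspace S" and K: "K \<subseteq> S" and F: "cone_face F K"
  shows "cone_face (f ` F) K'"
proof -
  have FK: "F \<subseteq> K" using F by (simp add: cone_face_def)
  have add: "f (x + y) = f x + f y" if "x \<in> K" "y \<in> K" for x y
    using f subsetD[OF K that(1)] subsetD[OF K that(2)] by (simp add: cone_iso_def)
  have scale: "f (c *\<^sub>R x) = c *\<^sub>R f x" if "x \<in> K" for c x
    using f subsetD[OF K that] by (simp add: cone_iso_def)
  have K': "K' = f ` K" using f by (simp add: cone_iso_def)
  have cone: "convex_cone F" using F by (simp add: cone_face_def)
  have "convex_cone (f ` F)"
    unfolding convex_cone_iff
  proof (intro conjI ballI allI impI)
    have "0 \<in> F" using cone by (simp add: convex_cone_iff)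
    then show "0 \<in> f ` F" using scale[of 0 0] FK by force
  next
    fix x y assume "x \<in> f ` F" "y \<in> f ` F"
    then obtain a b where "a \<in> F" "b \<in> F" "x = f a" "y = f b" by blast
    moreover from this have "a + b \<in> F" using cone by (simp add: convex_cone_iff)
    ultimately show "x + y \<in> f ` F" using add FK by (metis image_eqI subsetD)
  next
    fix x and c :: real assume "x \<in> f ` F" "0 \<le> c"
    then obtain a where "a \<in> F" "x = f a" by blast
    moreover from this \<open>0 \<le> c\<close> have "c *\<^sub>R a \<in> F" using cone by (simp add: convex_cone_iff)
    ultimately show "c *\<^sub>R x \<in> f ` F" using scale FK by (metis image_eqI subsetD)
  qed
  moreover have "x \<in> f ` F \<and> y \<in> f ` F" if xy: "x \<in> K'" "y \<in> K'" "x + y \<in> f ` F" for x y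
  proof -
    from xy K' obtain a b c where abc: "a \<in> K" "b \<in> K" "c \<in> F" "x = f a" "y = f b" "x + y = f c" by blast
    then have "f (a + b) = f c" using add by simp
    moreover have "a + b \<in> S" "c \<in> S" using abc K FK S by (auto intro: subspace_add)
    moreover have "inj_on f S" using f by (simp add: cone_iso_def bij_betw_def)
    ultimately have "a + b = c" by (meson inj_onD)
    with abc F have "a \<in> F \<and> b \<in> F" by (simp add: cone_face_def)
    with abc show ?thesis by blast
  qed
  ultimately show ?thesis using FK K' by (auto simp: cone_face_def)
qed

text \<open>
  For \<open>x\<close> in a convex cone \<open>K\<close>, this is the smallest face of \<open>K\<close> that contains \<open>x\<close>. It is described
  without reference to a face, so its images under isomorphisms are immediate.
\<close>
definition minimal_face :: "'a::real_vector set \<Rightarrow> 'a \<Rightarrow> 'a set" where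
  "minimal_face K x = {y \<in> K. \<exists>\<epsilon>>0. x - \<epsilon> *\<^sub>R y \<in> K}"

text \<open>
  From a relative interior point one can move a little further away from any \<open>y \<in> F\<close> inside \<open>F\<close>, so
  after scaling \<open>x - \<epsilon> *\<^sub>R y \<in> F\<close>. Conversely \<open>x = (x - \<epsilon> *\<^sub>R y) + \<epsilon> *\<^sub>R y\<close> exhibits \<open>\<epsilon> *\<^sub>R y\<close> as a
  summand of an element of the face.
\<close>
lemma cone_face_eq_minimal_face:
  fixes K :: "'a::euclidean_space set"
  assumes F: "cone_face F K" and K: "conic K" and x: "x \<in> rel_interior F"
  shows "F = minimal_face K x"
proof
  have FK: "F \<subseteq> K" and cone: "convex F" "conic F" "F \<noteq> {}"
    using F by (auto simp: cone_face_def convex_cone_def)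
  show "F \<subseteq> minimal_face K x"
  proof
    fix y assume y: "y \<in> F"
    with x obtain e where e: "1 < e" "(1 - e) *\<^sub>R y + e *\<^sub>R x \<in> F"
      using convex_rel_interior_iff[OF cone(1,3)] by blast
    then have "(1 / e) *\<^sub>R ((1 - e) *\<^sub>R y + e *\<^sub>R x) \<in> F"
      by (intro conicD[OF cone(2)]) auto
    also have "(1 / e) *\<^sub>R ((1 - e) *\<^sub>R y + e *\<^sub>R x) = x - ((e - 1) / e) *\<^sub>R y"
      using e(1) by (simp add: scaleR_add_right diff_divide_distrib algebra_simps)
    finally have "x - ((e - 1) / e) *\<^sub>R y \<in> K" using FK by blast
    moreover have "0 < (e - 1) / e" using e(1) by simp
    ultimately show "y \<in> minimal_face K x" using y FK by (auto simp: minimal_face_def)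
  qed
  show "minimal_face K x \<subseteq> F"
  proof
    fix y assume "y \<in> minimal_face K x"
    then obtain \<epsilon> where e: "0 < \<epsilon>" "x - \<epsilon> *\<^sub>R y \<in> K" and y: "y \<in> K"
      by (auto simp: minimal_face_def)
    have "\<epsilon> *\<^sub>R y \<in> K" using y e(1) conicD[OF K] by simp
    moreover have "x - \<epsilon> *\<^sub>R y + \<epsilon> *\<^sub>R y \<in> F" using x rel_interior_subset by auto
    ultimately have "\<epsilon> *\<^sub>R y \<in> F" using F e(2) unfolding cone_face_def by blast
    then have "(1 / \<epsilon>) *\<^sub>R \<epsilon> *\<^sub>R y \<in> F" using e(1) by (simp only: conicD[OF cone(2)] divide_nonneg_pos zero_le_one)
    moreover have "(1 / \<epsilon>) *\<^sub>R \<epsilon> *\<^sub>R y = y" using e(1) by simp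
    ultimately show "y \<in> F" by metis
  qed
qed

lemma minimal_face_cone_iso:
  assumes f: "cone_iso S K S' K' f" and S: "subspace S" and K: "K \<subseteq> S" and x: "x \<in> S"
  shows "f ` minimal_face K x = minimal_face K' (f x)"
proof -
  have K': "K' = f ` K" and inj: "inj_on f S" using f by (auto simp: cone_iso_def bij_betw_def)
  have diff: "f (x - e *\<^sub>R y) = f x - e *\<^sub>R f y" if "y \<in> K" for e y
  proof -
    have "x - e *\<^sub>R y = x + (- e) *\<^sub>R y" by simp
    moreover have "f (x + (- e) *\<^sub>R y) = f x + (- e) *\<^sub>R f y"
      using f x subspace_scale[OF S subsetD[OF K that]] subsetD[OF K that]
      by (simp add: cone_iso_def del: scaleR_minus_left add_uminus_conv_diff)
    ultimately show ?thesis by simp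
  qed
  have iff: "f x - e *\<^sub>R f y \<in> K' \<longleftrightarrow> x - e *\<^sub>R y \<in> K" if "y \<in> K" for e y
  proof -
    have "x - e *\<^sub>R y \<in> S" using S x K that by (auto intro!: subspace_diff subspace_scale)
    then show ?thesis unfolding K' diff[OF that, symmetric] using inj_on_image_mem_iff[OF inj _ K] by blast
  qed
  have "minimal_face K' (f x) = f ` {y \<in> K. \<exists>\<epsilon>>0. f x - \<epsilon> *\<^sub>R f y \<in> K'}"
    unfolding minimal_face_def K' by blast
  also have "{y \<in> K. \<exists>\<epsilon>>0. f x - \<epsilon> *\<^sub>R f y \<in> K'} = minimal_face K x"
    unfolding minimal_face_def using iff by blast
  finally show ?thesis by simp
qed

section \<open>The cone of projected positive semidefinite matrices\<close>

lemma subspace_pattern_space: "subspace (pattern_space E)"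
  by (auto simp: subspace_def pattern_space_def transpose_def vec_eq_iff)

lemma psd_transpose: "psd w \<Longrightarrow> transpose w = w"
  by (simp add: psd_def)

lemma pattern_cone_subset_space: "pattern_cone E \<subseteq> pattern_space E"
  by (auto simp: pattern_cone_def pattern_proj_in_space psd_transpose)

lemma conic_pattern_cone: "conic (pattern_cone E)"
  unfolding conic_def pattern_cone_def
proof (intro allI impI)
  fix x and c :: real assume "x \<in> pattern_proj E ` {A. psd A}" "0 \<le> c"
  then obtain w where "psd w" "x = pattern_proj E w" by blast
  with \<open>0 \<le> c\<close> show "c *\<^sub>R x \<in> pattern_proj E ` {A. psd A}"
    by (intro image_eqI[of _ _ "c *\<^sub>R w"]) (simp_all add: psd_scaleR pattern_proj_scaleR)
qed

lemma pattern_proj_diag: "pattern_proj E A $ i $ i = A $ i $ i"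
  by (simp add: pattern_proj_nth)

lemma pattern_cone_diag_nonneg: "x \<in> pattern_cone E \<Longrightarrow> 0 \<le> x $ i $ i"
  by (auto simp: pattern_cone_def pattern_proj_diag psd_diag_nonneg)

text \<open>
  A completion with zero diagonal entries outside \<open>W\<close> has zero rows there.
\<close>
lemma sub_cone_iff_psd:
  "x \<in> sub_cone E W \<longleftrightarrow>
    (\<exists>w. psd w \<and> (\<forall>i j. i \<notin> W \<or> j \<notin> W \<longrightarrow> w $ i $ j = 0) \<and> x = pattern_proj E w)"
proof
  assume x: "x \<in> sub_cone E W"
  then obtain w where w: "psd w" "x = pattern_proj E w" by (auto simp: sub_cone_def pattern_cone_def)
  have "w $ i $ i = 0" if "i \<notin> W" for i
    using x that w(2) pattern_proj_diag[of E w i] by (simp add: sub_cone_def)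
  then have "w $ i $ j = 0" if "i \<notin> W \<or> j \<notin> W" for i j
    using that psd_zero_diag(1)[OF w(1), of i j] psd_zero_diag(2)[OF w(1), of j i] by blast
  with w show "\<exists>w. psd w \<and> (\<forall>i j. i \<notin> W \<or> j \<notin> W \<longrightarrow> w $ i $ j = 0) \<and> x = pattern_proj E w"
    by blast
qed (auto simp: sub_cone_def pattern_cone_def pattern_proj_nth)

lemma psd_e_mat: "psd (e_mat I)"
  using psd_mult_transpose[of "e_mat I"] by (simp add: e_mat_idem)

lemma pattern_proj_e_mat: "pattern_proj E (e_mat I) = e_mat I"
  by (auto simp: vec_eq_iff pattern_proj_nth e_mat_def)

lemma e_mat_in_sub_cone: "e_mat I \<in> sub_cone E (- I)"
  unfolding sub_cone_iff_psd
  by (intro exI[of _ "e_mat I"]) (simp add: psd_e_mat pattern_proj_e_mat, simp add: e_mat_def)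

lemma psd_mat_1_minus:
  assumes "psd w"
  obtains \<epsilon> where "0 < \<epsilon>" "psd (mat 1 - \<epsilon> *\<^sub>R w)"
proof -
  obtain B where B: "0 < B" "\<And>v. norm (w *v v) \<le> norm v * B"
    using bounded_linear.pos_bounded[OF matrix_vector_mul_bounded_linear[of w]] by blast
  have "0 \<le> v \<bullet> ((mat 1 - (1 / B) *\<^sub>R w) *v v)" for v
  proof -
    have "v \<bullet> (w *v v) \<le> norm v * norm (w *v v)" by (rule norm_cauchy_schwarz)
    also have "\<dots> \<le> norm v * (norm v * B)" by (intro mult_left_mono B(2)) simp
    finally have "v \<bullet> (w *v v) / B \<le> v \<bullet> v"
      using B(1) by (simp add: field_simps dot_square_norm power2_eq_square)
    then show ?thesis
      by (simp add: matrix_vector_mult_diff_rdistrib inner_diff_right flip: scaleR_matrix_vector_assoc)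
  qed
  moreover have "transpose (mat 1 - (1 / B) *\<^sub>R w) = mat 1 - (1 / B) *\<^sub>R w"
    using psd_sym[OF assms] by (auto simp: transpose_def vec_eq_iff mat_def)
  ultimately show ?thesis using that[of "1 / B"] B(1) by (simp add: psd_def)
qed

text \<open>
  Subtracting \<open>\<epsilon> *\<^sub>R y\<close> from \<^term>\<open>e_mat I\<close> keeps the diagonal nonnegative on \<open>I\<close> only if \<open>y\<close> vanishes
  there. If it does, a small multiple of a completion of \<open>y\<close> can be subtracted from the identity, and
  compressing to the complement of \<open>I\<close> loses nothing.
\<close>
lemma minimal_face_e_mat: "minimal_face (pattern_cone E) (e_mat I) = sub_cone E (- I)"
proof
  show "minimal_face (pattern_cone E) (e_mat I) \<subseteq> sub_cone E (- I)"
  proof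
    fix y assume "y \<in> minimal_face (pattern_cone E) (e_mat I)"
    then obtain \<epsilon> where y: "y \<in> pattern_cone E" and e: "0 < \<epsilon>" "e_mat I - \<epsilon> *\<^sub>R y \<in> pattern_cone E"
      by (auto simp: minimal_face_def)
    from y obtain w where w: "psd w" "y = pattern_proj E w" by (auto simp: pattern_cone_def)
    have "w $ i $ i = 0" if "i \<in> I" for i
    proof -
      have "0 \<le> (e_mat I - \<epsilon> *\<^sub>R y) $ i $ i" using e(2) by (rule pattern_cone_diag_nonneg)
      then have "w $ i $ i \<le> 0"
        using that e(1) by (simp add: e_mat_def w(2) pattern_proj_diag mult_le_0_iff)
      with psd_diag_nonneg[OF w(1), of i] show ?thesis by simp
    qed
    then have "w $ i $ j = 0" if "i \<in> I \<or> j \<in> I" for i j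
      using that psd_zero_diag(1)[OF w(1), of i j] psd_zero_diag(2)[OF w(1), of j i] by blast
    with w show "y \<in> sub_cone E (- I)" by (auto simp: sub_cone_iff_psd)
  qed
  show "sub_cone E (- I) \<subseteq> minimal_face (pattern_cone E) (e_mat I)"
  proof
    fix y assume y: "y \<in> sub_cone E (- I)"
    then obtain w where w: "psd w" "\<And>i j. i \<in> I \<or> j \<in> I \<Longrightarrow> w $ i $ j = 0" "y = pattern_proj E w"
      by (auto simp: sub_cone_iff_psd)
    obtain \<epsilon> where e: "0 < \<epsilon>" "psd (mat 1 - \<epsilon> *\<^sub>R w)" using psd_mat_1_minus[OF w(1)] .
    have "psd (e_mat I ** (mat 1 - \<epsilon> *\<^sub>R w) ** transpose (e_mat I))" by (rule psd_congruence) fact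
    also have "e_mat I ** (mat 1 - \<epsilon> *\<^sub>R w) ** transpose (e_mat I) = e_mat I - \<epsilon> *\<^sub>R w"
      using w(2) by (auto simp: vec_eq_iff mult_e_mat_nth e_mat_mult_nth) (auto simp: e_mat_def mat_def)
    finally have "pattern_proj E (e_mat I - \<epsilon> *\<^sub>R w) \<in> pattern_cone E"
      by (auto simp: pattern_cone_def)
    then have "e_mat I - \<epsilon> *\<^sub>R y \<in> pattern_cone E"
      by (simp add: pattern_proj_diff pattern_proj_scaleR pattern_proj_e_mat w(3))
    with e(1) y show "y \<in> minimal_face (pattern_cone E) (e_mat I)"
      by (auto simp: minimal_face_def sub_cone_def)
  qed
qed

text \<open>
  The projection restricts a matrix to the block \<open>W \<times> W\<close> and commutes with
  \<^const>\<open>pattern_proj\<close>; restricting a completion to the block keeps it positive semidefinite.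
\<close>
lemma projectionally_exposed_sub_cone:
  "projectionally_exposed (pattern_space E) (pattern_cone E) (sub_cone E W)"
proof -
  define P where "P = (\<lambda>x. e_mat (- W) ** x ** e_mat (- W) :: real^'a^'a)"
  have P_nth: "P x $ i $ j = (if i \<in> W \<and> j \<in> W then x $ i $ j else 0)" for x i j
    by (simp add: P_def mult_e_mat_nth e_mat_mult_nth)
  have "linear_endo (pattern_space E) P"
    by (auto simp: linear_endo_def pattern_space_def P_nth vec_eq_iff transpose_def)
  moreover have "P (P x) = P x" for x by (simp add: P_nth vec_eq_iff)
  moreover have "P ` pattern_cone E = sub_cone E W"
  proof
    show "P ` pattern_cone E \<subseteq> sub_cone E W"
    proof
      fix y assume "y \<in> P ` pattern_cone E"
      then obtain w where w: "psd w" "y = P (pattern_proj E w)" by (auto simp: pattern_cone_def)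
      have "psd (P w)" using psd_congruence[OF w(1), of "e_mat (- W)"] by (simp add: P_def)
      moreover have "y = pattern_proj E (P w)" by (simp add: w(2) vec_eq_iff P_nth pattern_proj_nth)
      ultimately show "y \<in> sub_cone E W" unfolding sub_cone_iff_psd by (auto simp: P_nth)
    qed
    show "sub_cone E W \<subseteq> P ` pattern_cone E"
    proof
      fix y assume y: "y \<in> sub_cone E W"
      then have "P y = y" unfolding sub_cone_iff_psd by (auto simp: vec_eq_iff P_nth pattern_proj_nth)
      moreover have "y \<in> pattern_cone E" using y by (simp add: sub_cone_def)
      ultimately show "y \<in> P ` pattern_cone E" by (metis imageI)
    qed
  qed
  ultimately show ?thesis by (auto simp: projectionally_exposed_def)
qed

section \<open>The triangular group acts by automorphisms\<close>

lemma Q_map_pattern_proj: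
  assumes "trivially_perfect_elim_ordering E" "u \<in> T_plusplus E" "transpose w = w"
  shows "Q_map E u (pattern_proj E w) = pattern_proj E (u ** w ** transpose u)"
  using assms by (simp add: Q_map_eq_congruence T_plusplus_iff pattern_proj_in_space pattern_proj_congruence)

lemma Q_map_in_space:
  assumes "trivially_perfect_elim_ordering E" "u \<in> T_plusplus E" "x \<in> pattern_space E"
  shows "Q_map E u x \<in> pattern_space E"
proof -
  have "transpose x = x" using assms(3) by (simp add: pattern_space_def)
  then show ?thesis
    using assms by (simp add: Q_map_eq_congruence T_plusplus_iff pattern_proj_in_space transpose_congruence)
qed

lemma Q_map_in_cone:
  assumes "trivially_perfect_elim_ordering E" "u \<in> T_plusplus E" "x \<in> pattern_cone E"
  shows "Q_map E u x \<in> pattern_cone E"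
proof -
  from assms(3) obtain w where "psd w" "x = pattern_proj E w" by (auto simp: pattern_cone_def)
  with assms(1,2) show ?thesis
    by (auto simp: Q_map_pattern_proj psd_transpose pattern_cone_def intro!: imageI psd_congruence)
qed

lemma Q_map_inverse:
  assumes "trivially_perfect_elim_ordering E" "u \<in> T_plusplus E" "v \<in> T_plusplus E"
    "u ** v = mat 1" "x \<in> pattern_space E"
  shows "Q_map E u (Q_map E v x) = x"
proof -
  have "Q_map E u (Q_map E v x) = Q_map E (mat 1) x"
    using Q_map_comp[OF assms(1,2,3,5)] assms(4) by simp
  also have "\<dots> = x"
    using assms(1,5) mat_1_T_plusplus[of E]
    by (simp add: Q_map_eq_congruence T_plusplus_iff pattern_proj_pattern_space)
  finally show ?thesis .
qed

lemma Q_map_cone_iso: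
  assumes tpeo: "trivially_perfect_elim_ordering E" and u: "u \<in> T_plusplus E"
  shows "cone_iso (pattern_space E) (pattern_cone E) (pattern_space E) (pattern_cone E) (Q_map E u)"
proof -
  obtain v where v: "v \<in> T_plusplus E" "v ** u = mat 1" "u ** v = mat 1"
    using T_plusplus_inverse[OF tpeo u] .
  have bij: "bij_betw (Q_map E u) (pattern_space E) (pattern_space E)"
    by (rule bij_betw_byWitness[where f' = "Q_map E v"])
      (use Q_map_inverse[OF tpeo] Q_map_in_space[OF tpeo] u v in auto)
  have onto: "x \<in> Q_map E u ` pattern_cone E" if "x \<in> pattern_cone E" for x
    using Q_map_inverse[OF tpeo u v(1,3)] Q_map_in_cone[OF tpeo v(1) that] that pattern_cone_subset_space
    by (metis imageI subsetD)
  have upper: "u \<in> upper_pattern E" using u by (simp add: T_plusplus_iff)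
  have "Q_map E u (x + y) = Q_map E u x + Q_map E u y" if "x \<in> pattern_space E" "y \<in> pattern_space E" for x y
  proof -
    have "u ** (x + y) ** transpose u = u ** x ** transpose u + u ** y ** transpose u"
      by (simp add: vec_eq_iff congruence_nth sum.distrib algebra_simps)
    then show ?thesis
      using that subspace_add[OF subspace_pattern_space that]
      by (simp add: Q_map_eq_congruence[OF tpeo upper] pattern_proj_add)
  qed
  moreover have "Q_map E u (c *\<^sub>R x) = c *\<^sub>R Q_map E u x" if "x \<in> pattern_space E" for c x
  proof -
    have "u ** (c *\<^sub>R x) ** transpose u = c *\<^sub>R (u ** x ** transpose u)"
      by (simp add: vec_eq_iff congruence_nth sum_distrib_left mult_ac)
    then show ?thesis
      using that subspace_scale[OF subspace_pattern_space that, of c]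
      by (simp add: Q_map_eq_congruence[OF tpeo upper] pattern_proj_scaleR)
  qed
  moreover have "Q_map E u ` pattern_cone E = pattern_cone E"
    using onto Q_map_in_cone[OF tpeo u] by blast
  ultimately show ?thesis using bij by (simp add: cone_iso_def)
qed

text \<open>
  The action multiplies the \<open>i\<close>-th diagonal entry of the \<open>i\<close>-th diagonal unit matrix by
  \<open>(v $ i $ i)\<^sup>2\<close>, so each \<open>i \<in> W\<close> remains visible in the image. This is why the induced subgraph of a
  face does not depend on the choice of \<open>u\<close>.
\<close>
lemma Q_map_sub_cone_subset:
  assumes tpeo: "trivially_perfect_elim_ordering E" and v: "v \<in> T_plusplus E"
    and sub: "Q_map E v ` sub_cone E W \<subseteq> sub_cone E W'"
  shows "W \<subseteq> W'"
proof
  fix i assume "i \<in> W"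
  then have "e_mat (- {i}) \<in> sub_cone E W"
    using e_mat_in_sub_cone[of "- {i}" E] by (auto simp: sub_cone_def)
  with sub have "Q_map E v (e_mat (- {i})) \<in> sub_cone E W'" by blast
  moreover have "Q_map E v (e_mat (- {i})) $ i $ i = (v $ i $ i)\<^sup>2"
  proof -
    have "Q_map E v (e_mat (- {i})) = pattern_proj E (v ** e_mat (- {i}) ** transpose v)"
      using Q_map_pattern_proj[OF tpeo v, of "e_mat (- {i})"] by (simp add: pattern_proj_e_mat)
    then have "Q_map E v (e_mat (- {i})) $ i $ i = (\<Sum>l\<in>UNIV. (v ** e_mat (- {i})) $ i $ l * v $ i $ l)"
      by (simp add: pattern_proj_diag) (simp add: matrix_matrix_mult_def transpose_def)
    also have "\<dots> = (\<Sum>l\<in>UNIV. if l = i then (v $ i $ i)\<^sup>2 else 0)"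
      by (rule sum.cong) (auto simp: mult_e_mat_nth power2_eq_square)
    finally show ?thesis by simp
  qed
  moreover have "0 < v $ i $ i" using v by (simp add: T_plusplus_def)
  ultimately have "Q_map E v (e_mat (- {i})) \<in> sub_cone E W'" "Q_map E v (e_mat (- {i})) $ i $ i \<noteq> 0"
    by simp_all
  then show "i \<in> W'" unfolding sub_cone_def by blast
qed

section \<open>Rank and determinant of completions\<close>

lemma rank_congruence_le: "rank (u ** w ** transpose u) \<le> rank w" for u w :: "real^'n^'n"
  using rank_mul_le_left[of "u ** w" "transpose u"] rank_mul_le_right[of u w] by linarith

lemma rank_congruence:
  fixes u v w :: "real^'n^'n"
  assumes "v ** u = mat 1"
  shows "rank (u ** w ** transpose u) = rank w"
proof -
  have "v ** (u ** w ** transpose u) ** transpose v = (v ** u) ** w ** transpose (v ** u)"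
    by (simp add: matrix_transpose_mul matrix_mul_assoc)
  then have "w = v ** (u ** w ** transpose u) ** transpose v" using assms by simp
  then show ?thesis
    using rank_congruence_le[of v "u ** w ** transpose u"] rank_congruence_le[of u w] by simp
qed

lemma rank_e_mat: "rank (e_mat I :: real^'n^'n) = card (- I)"
proof -
  have fix_iff: "e_mat I *v x = x \<longleftrightarrow> (\<forall>i. i \<notin> - I \<longrightarrow> x $ i = 0)" for x :: "real^'n"
  proof -
    have "(e_mat I *v x) $ i = (if i \<in> I then 0 else x $ i)" for i
    proof -
      have "e_mat I $ i $ k * x $ k = (if k = i then if i \<in> I then 0 else x $ i else 0)" for k
        by (simp add: e_mat_def)
      then show ?thesis by (simp add: matrix_vector_mult_def)
    qed
    then show ?thesis by (auto simp: vec_eq_iff)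
  qed
  have "range ((*v) (e_mat I)) = {x :: real^'n. e_mat I *v x = x}"
  proof
    show "range ((*v) (e_mat I)) \<subseteq> {x :: real^'n. e_mat I *v x = x}"
      by (auto simp: matrix_vector_mul_assoc e_mat_idem)
    show "{x :: real^'n. e_mat I *v x = x} \<subseteq> range ((*v) (e_mat I))"
      by (metis (mono_tags) mem_Collect_eq rangeI subsetI)
  qed
  then have "rank (e_mat I :: real^'n^'n) = dim {x :: real^'n. \<forall>i. i \<notin> - I \<longrightarrow> x $ i = 0}"
    by (simp only: rank_dim_range fix_iff)
  moreover have "vec.dim {x :: real^'n. \<forall>i. i \<notin> - I \<longrightarrow> x $ i = 0} = card (- I)"
    by (rule dim_substandard_cart)
  ultimately show ?thesis by (simp only: dim_vec_eq)
qed

text \<open>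
  Hadamard's inequality with its equality case. For the complete graph every ordering is a
  trivially perfect elimination ordering and the projection is the identity, so
  \<open>w = s ** transpose s\<close> with \<open>s\<close> triangular. The rows of \<open>s\<close> are unit vectors, hence its diagonal
  entries are at most one; if their product is one, they leave no room for other entries.
\<close>
lemma psd_unit_diagonal_det_le_1:
  fixes w :: "real^'n::{finite,linorder}^'n::{finite,linorder}"
  assumes w: "psd w" and diag: "\<And>i. w $ i $ i = 1"
  shows "det w \<le> 1" and "det w = 1 \<Longrightarrow> w = mat 1"
proof -
  \<comment> \<open>all pairs are edges, so the projection below is the identity\<close>
  let ?E = "UNIV :: 'n set set"
  have "trivially_perfect_elim_ordering ?E" by (simp add: trivially_perfect_elim_ordering_def)
  moreover have proj: "pattern_proj ?E A = A" for A
    by (simp add: vec_eq_iff pattern_proj_def)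
  ultimately obtain s where s: "s \<in> T_plus ?E" and ws: "w = s ** transpose s"
    using pattern_cone_triangular_factor[of ?E w] w by (metis pattern_cone_def imageI mem_Collect_eq)
  have nonneg: "0 \<le> s $ i $ i" for i using s by (simp add: T_plus_def)
  have row: "(\<Sum>k\<in>UNIV. (s $ i $ k)\<^sup>2) = 1" for i
    using diag[of i] by (simp add: ws mult_transpose_nth power2_eq_square)
  have "(s $ i $ i)\<^sup>2 \<le> 1" for i
    using member_le_sum[of i UNIV "\<lambda>k. (s $ i $ k)\<^sup>2"] row[of i] by simp
  then have le1: "s $ i $ i \<le> 1" for i using power2_le_imp_le[of "s $ i $ i" 1] by simp
  define d where "d = (\<Prod>i\<in>UNIV. s $ i $ i)"
  have d: "0 \<le> d" "d \<le> 1" unfolding d_def using nonneg le1 by (auto intro: prod_nonneg prod_le_1)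
  have "det s = d"
    unfolding d_def by (rule det_upper_triangular) (use s in \<open>auto simp: T_plus_def\<close>)
  then have det: "det w = d\<^sup>2" by (simp add: ws det_mul power2_eq_square)
  then show "det w \<le> 1" using d by (simp add: power_le_one)
  assume "det w = 1"
  with det d have "d = 1" by (simp add: power2_eq_1_iff)
  have one: "s $ i $ i = 1" for i
  proof -
    have "d = s $ i $ i * (\<Prod>k\<in>UNIV-{i}. s $ k $ k)" unfolding d_def by (simp add: prod.remove)
    also have "\<dots> \<le> s $ i $ i * 1"
      using nonneg le1 by (intro mult_left_mono prod_le_1) auto
    finally show ?thesis using \<open>d = 1\<close> le1[of i] by simp
  qed
  have "s $ i $ k = 0" if "i \<noteq> k" for i k
  proof -
    have "(\<Sum>k\<in>UNIV-{i}. (s $ i $ k)\<^sup>2) = 0"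
      using row[of i] one[of i] by (simp add: sum.remove[of UNIV i])
    then show ?thesis using that by (simp add: sum_nonneg_eq_0_iff)
  qed
  with one have "s = mat 1" by (simp add: vec_eq_iff mat_def)
  then show "w = mat 1" by (simp add: ws)
qed

text \<open>
  All completions of \<open>x\<close> become completions of one diagonal matrix after the same congruence. The
  questions on rank and determinant reduce to this case.
\<close>
lemma normalized_congruence:
  fixes u t w :: "real^'n::{finite,linorder}^'n::{finite,linorder}"
  assumes tpeo: "trivially_perfect_elim_ordering E" and u: "u \<in> T_plusplus E"
    and ut: "u ** t = e_mat I"
    and w: "pattern_proj E w = pattern_proj E (t ** transpose t)"
  shows "pattern_proj E (u ** w ** transpose u) = e_mat I"
proof -
  have "u \<in> upper_pattern E" using u by (simp add: T_plusplus_iff)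
  then have "pattern_proj E (u ** w ** transpose u) = pattern_proj E (u ** (t ** transpose t) ** transpose u)"
    using pattern_proj_congruence[OF tpeo] w by metis
  also have "u ** (t ** transpose t) ** transpose u = (u ** t) ** transpose (u ** t)"
    by (simp add: matrix_transpose_mul matrix_mul_assoc)
  finally show ?thesis by (simp add: ut e_mat_idem pattern_proj_e_mat)
qed

lemma rank_triangular_product:
  fixes t :: "real^'n::{finite,linorder}^'n::{finite,linorder}"
  assumes tpeo: "trivially_perfect_elim_ordering E" and t: "t \<in> T_plus E" "proper_matrix t"
  shows "rank (t ** transpose t) = card (- zero_diag t)"
proof -
  obtain u where u: "u \<in> T_plusplus E" "u ** t = e_mat (zero_diag t)"
    using triangular_factor_normalizer[OF tpeo t] .
  obtain v where v: "v ** u = mat 1" using T_plusplus_inverse[OF tpeo u(1)] by metis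
  have "u ** (t ** transpose t) ** transpose u = (u ** t) ** transpose (u ** t)"
    by (simp add: matrix_transpose_mul matrix_mul_assoc)
  then have "rank (t ** transpose t) = rank (e_mat (zero_diag t) :: real^'n::_^'n::_)"
    using rank_congruence[OF v, of "t ** transpose t"] by (simp add: u(2) e_mat_idem)
  then show ?thesis by (simp add: rank_e_mat)
qed

text \<open>
  A completion of \<^term>\<open>e_mat I\<close> has zero diagonal entries on \<open>I\<close>, hence zero rows there, so its
  rank is at most that of \<^term>\<open>e_mat I\<close>.
\<close>
lemma triangular_product_max_rank:
  fixes t :: "real^'n::{finite,linorder}^'n::{finite,linorder}"
  assumes tpeo: "trivially_perfect_elim_ordering E" and t: "t \<in> T_plus E" "proper_matrix t"
  shows "is_max_rank_completion E (pattern_proj E (t ** transpose t)) (t ** transpose t)"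
  unfolding is_max_rank_completion_def psd_completion_def
proof (intro conjI allI impI)
  fix w assume w: "psd w \<and> pattern_proj E w = pattern_proj E (t ** transpose t)"
  obtain u where u: "u \<in> T_plusplus E" "u ** t = e_mat (zero_diag t)"
    using triangular_factor_normalizer[OF tpeo t] .
  obtain v where v: "v ** u = mat 1" using T_plusplus_inverse[OF tpeo u(1)] by metis
  define w' where "w' = u ** w ** transpose u"
  have psd: "psd w'" unfolding w'_def using w by (intro psd_congruence) simp
  have proj: "pattern_proj E w' = e_mat (zero_diag t)"
    unfolding w'_def using normalized_congruence[OF tpeo u] w by blast
  have "w' $ i $ j = 0" if "i \<in> zero_diag t" for i j
  proof -
    have "w' $ i $ i = 0" using that proj pattern_proj_diag[of E w' i] by (simp add: e_mat_def)
    with psd show ?thesis by (rule psd_zero_diag)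
  qed
  then have "e_mat (zero_diag t) ** w' = w'" by (simp add: vec_eq_iff e_mat_mult_nth)
  then have "rank w' \<le> rank (e_mat (zero_diag t) :: real^'n::_^'n::_)" by (metis rank_mul_le_left)
  moreover have "rank w' = rank w" unfolding w'_def by (rule rank_congruence[OF v])
  ultimately show "rank w \<le> rank (t ** transpose t)"
    by (simp add: rank_e_mat rank_triangular_product[OF tpeo t])
qed (simp_all add: psd_mult_transpose)

text \<open>
  After normalization the completions are completions of the identity matrix, and
  \<open>psd_unit_diagonal_det_le_1\<close> singles out the identity itself, which corresponds to
  \<open>t ** transpose t\<close>. The congruence multiplies all determinants by the same positive number.
\<close>
lemma triangular_product_max_det:
  fixes t :: "real^'n::{finite,linorder}^'n::{finite,linorder}"
  assumes tpeo: "trivially_perfect_elim_ordering E" and t: "t \<in> T_plus E" "proper_matrix t"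
    and nonsing: "zero_diag t = {}"
  defines "x \<equiv> pattern_proj E (t ** transpose t)"
  shows "is_max_det_completion E x (t ** transpose t)"
    and "is_max_det_completion E x w \<Longrightarrow> w = t ** transpose t"
proof -
  obtain u where u: "u \<in> T_plusplus E" "u ** t = e_mat (zero_diag t)"
    using triangular_factor_normalizer[OF tpeo t] .
  obtain v where v: "v ** u = mat 1" using T_plusplus_inverse[OF tpeo u(1)] by metis
  have "(e_mat {} :: real^'n::_^'n::_) = mat 1" by (simp add: e_mat_def mat_def)
  then have ut: "u ** t = mat 1" using u(2) nonsing by simp
  have tt: "u ** (t ** transpose t) ** transpose u = mat 1"
  proof -
    have "u ** (t ** transpose t) ** transpose u = (u ** t) ** transpose (u ** t)"
      by (simp add: matrix_transpose_mul matrix_mul_assoc)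
    then show ?thesis by (simp add: ut)
  qed
  have det: "det (u ** w ** transpose u) = (det u)\<^sup>2 * det w" for w
    by (simp add: det_mul power2_eq_square)
  have pos: "0 < (det u)\<^sup>2"
    using T_plusplus_invertible[OF u(1)] by (simp add: invertible_det_nz)
  have det_tt: "(det u)\<^sup>2 * det (t ** transpose t) = 1"
    using det[of "t ** transpose t"] by (simp add: tt)
  have compl: "psd (u ** w ** transpose u)" "\<And>i. (u ** w ** transpose u) $ i $ i = 1"
    if w: "psd_completion E x w" for w
  proof -
    show "psd (u ** w ** transpose u)" using w by (simp add: psd_completion_def psd_congruence)
    have "pattern_proj E (u ** w ** transpose u) = e_mat (zero_diag t)"
      using normalized_congruence[OF tpeo u] w by (simp add: psd_completion_def x_def)
    then show "(u ** w ** transpose u) $ i $ i = 1" for i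
      using pattern_proj_diag[of E "u ** w ** transpose u" i] by (simp add: nonsing e_mat_def)
  qed
  have tt_compl: "psd_completion E x (t ** transpose t)"
    by (simp add: psd_completion_def psd_mult_transpose x_def)
  have "det w \<le> det (t ** transpose t)" if "psd_completion E x w" for w
  proof -
    have "(det u)\<^sup>2 * det w \<le> (det u)\<^sup>2 * det (t ** transpose t)"
      using psd_unit_diagonal_det_le_1(1)[OF compl[OF that]] by (simp only: det det_tt)
    then show ?thesis using pos by (rule mult_left_le_imp_le)
  qed
  with tt_compl show "is_max_det_completion E x (t ** transpose t)"
    by (simp add: is_max_det_completion_def)
  assume max: "is_max_det_completion E x w"
  then have w: "psd_completion E x w" by (simp add: is_max_det_completion_def)
  have "det (t ** transpose t) \<le> det w" using max tt_compl by (simp add: is_max_det_completion_def)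
  then have "1 \<le> (det u)\<^sup>2 * det w"
    using mult_left_mono[of "det (t ** transpose t)" "det w" "(det u)\<^sup>2"] det_tt pos by simp
  with psd_unit_diagonal_det_le_1(1)[OF compl[OF w]] have "det (u ** w ** transpose u) = 1"
    by (simp add: det)
  then have one: "u ** w ** transpose u = mat 1"
    by (rule psd_unit_diagonal_det_le_1(2)[OF compl[OF w]])
  have cancel: "w' = v ** (u ** w' ** transpose u) ** transpose v" for w'
  proof -
    have "v ** (u ** w' ** transpose u) ** transpose v = (v ** u) ** w' ** transpose (v ** u)"
      by (simp add: matrix_transpose_mul matrix_mul_assoc)
    then show ?thesis using v by simp
  qed
  show "w = t ** transpose t" using cancel[of w] cancel[of "t ** transpose t"] by (simp add: one tt)
qed

section \<open>Faces in a trivially perfect elimination ordering\<close>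

text \<open>
  Both sides are minimal faces of the same point: \<open>F\<close> is the minimal face of its relative interior
  point \<open>x\<close>, and the action of \<open>u\<close> moves \<open>x\<close> to \<^term>\<open>e_mat I\<close>.
\<close>
lemma Q_map_face:
  fixes F :: "(real^'n::{finite,linorder}^'n::{finite,linorder}) set"
  assumes tpeo: "trivially_perfect_elim_ordering E" and F: "cone_face F (pattern_cone E)"
    and x: "pattern_proj E (t ** transpose t) \<in> rel_interior F"
    and u: "u \<in> T_plusplus E" "u ** t = e_mat I"
  shows "Q_map E u ` F = sub_cone E (- I)"
proof -
  let ?x = "pattern_proj E (t ** transpose t)"
  have tt: "psd (t ** transpose t)" by (rule psd_mult_transpose)
  then have "?x \<in> pattern_cone E" by (auto simp: pattern_cone_def)
  then have "?x \<in> pattern_space E" using pattern_cone_subset_space by blast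
  then have "Q_map E u ` F = minimal_face (pattern_cone E) (Q_map E u ?x)"
    using minimal_face_cone_iso[OF Q_map_cone_iso[OF tpeo u(1)] subspace_pattern_space pattern_cone_subset_space]
      cone_face_eq_minimal_face[OF F conic_pattern_cone x] by simp
  also have "Q_map E u ?x = e_mat I"
    using Q_map_pattern_proj[OF tpeo u(1) psd_transpose[OF tt]] normalized_congruence[OF tpeo u refl] by simp
  finally show ?thesis by (simp add: minimal_face_e_mat)
qed

text \<open>
  The group element \<open>u' u\<^sup>-\<^sup>1\<close> maps one coordinate face to the other. Exchanging the roles of \<open>u\<close>
  and \<open>u'\<close> gives equality.
\<close>
lemma Q_map_sub_cone_unique:
  assumes tpeo: "trivially_perfect_elim_ordering E" and F: "F \<subseteq> pattern_space E"
    and u: "u \<in> T_plusplus E" "Q_map E u ` F = sub_cone E W"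
    and u': "u' \<in> T_plusplus E" "Q_map E u' ` F = sub_cone E W'"
  shows "W \<subseteq> W'"
proof -
  obtain v where v: "v \<in> T_plusplus E" "v ** u = mat 1" using T_plusplus_inverse[OF tpeo u(1)] by metis
  have "Q_map E (u' ** v) ` sub_cone E W \<subseteq> sub_cone E W'"
  proof
    fix z assume "z \<in> Q_map E (u' ** v) ` sub_cone E W"
    then obtain y where y: "y \<in> F" "z = Q_map E (u' ** v) (Q_map E u y)" unfolding u(2)[symmetric] by blast
    have "y \<in> pattern_space E" using y F by blast
    then have "z = Q_map E u' y"
      using y Q_map_comp[OF tpeo T_plusplus_mult[OF tpeo u'(1) v(1)] u(1)]
      by (simp add: v(2) flip: matrix_mul_assoc)
    with y u'(2) show "z \<in> sub_cone E W'" by blast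
  qed
  then show ?thesis by (rule Q_map_sub_cone_subset[OF tpeo T_plusplus_mult[OF tpeo u'(1) v(1)]])
qed

lemma face_rel_interior_nonempty:
  fixes F :: "'a::euclidean_space set"
  assumes "cone_face F K"
  shows "rel_interior F \<noteq> {}"
  using assms by (simp add: cone_face_def convex_cone_def rel_interior_eq_empty)

lemma face_normal_form:
  fixes F :: "(real^'n::{finite,linorder}^'n::{finite,linorder}) set"
  assumes tpeo: "trivially_perfect_elim_ordering E" and F: "cone_face F (pattern_cone E)"
  obtains u W where "u \<in> T_plusplus E" "Q_map E u ` F = sub_cone E W"
proof -
  obtain x where x: "x \<in> rel_interior F" using face_rel_interior_nonempty[OF F] by blast
  then have "x \<in> pattern_cone E" using F rel_interior_subset by (auto simp: cone_face_def)
  from pattern_cone_triangular_factor[OF tpeo this] obtain t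
    where t: "t \<in> T_plus E" "proper_matrix t" "x = pattern_proj E (t ** transpose t)" .
  obtain u where "u \<in> T_plusplus E" "u ** t = e_mat (zero_diag t)"
    using triangular_factor_normalizer[OF tpeo t(1,2)] .
  with Q_map_face[OF tpeo F] x t(3) that show ?thesis by blast
qed

section \<open>Existence of a trivially perfect elimination ordering up to relabelling\<close>

text \<open>
  A private neighbour on each side of an edge produces an induced path on four vertices or, if these
  two neighbours are adjacent, a chordless cycle of length four.
\<close>
lemma homogeneous_chordal_nested:
  fixes E :: "'a set set"
  assumes simple: "simple_graph E" and hom: "homogeneous_chordal E" and ij: "j \<in> closed_nbhd E i"
  shows "closed_nbhd E i \<subseteq> closed_nbhd E j \<or> closed_nbhd E j \<subseteq> closed_nbhd E i"
proof (rule ccontr)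
  assume "\<not> ?thesis"
  then obtain a b where a: "a \<in> closed_nbhd E i" "a \<notin> closed_nbhd E j"
    and b: "b \<in> closed_nbhd E j" "b \<notin> closed_nbhd E i" by blast
  have edges: "{a, i} \<in> E" "{i, j} \<in> E" "{j, b} \<in> E" "{a, j} \<notin> E" "{i, b} \<notin> E"
    and dist: "a \<noteq> i" "a \<noteq> j" "i \<noteq> j" "i \<noteq> b" "j \<noteq> b" "a \<noteq> b"
    using a b ij by (auto simp: closed_nbhd_def insert_commute)
  then have edges': "{i, a} \<in> E" "{j, i} \<in> E" "{b, j} \<in> E" "{j, a} \<notin> E" "{b, i} \<notin> E"
    by (simp_all add: insert_commute)
  have loop: "{x} \<notin> E" for x using simple unfolding simple_graph_def by fastforce
  show False
  proof (cases "{a, b} \<in> E")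
    case True
    let ?c = "[a, i, j, b]"
    have "is_cycle E ?c"
      using edges dist True by (simp add: is_cycle_def All_less_Suc insert_commute)
    moreover have "\<not> has_chord E ?c"
      using edges edges' loop by (simp add: has_chord_def Ex_less_Suc)
    moreover have "4 \<le> length ?c" by simp
    ultimately show False using hom unfolding homogeneous_chordal_def chordal_def by blast
  next
    case False
    then have False': "{b, a} \<notin> E" by (simp add: insert_commute)
    let ?f = "\<lambda>k::nat. [a, i, j, b] ! k" and ?W = "{a, i, j, b}"
    have lt4: "{..<4} = {0, 1, 2, 3::nat}" by auto
    have "bij_betw ?f {..<4} ?W"
      unfolding bij_betw_def lt4 using dist by (auto simp: inj_on_def)
    moreover have "{x, y} \<in> path_edges 4 \<longleftrightarrow> {?f x, ?f y} \<in> induced_edges E ?W"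
      if "x \<in> {..<4}" "y \<in> {..<4}" for x y
    proof -
      have path: "{x, y} \<in> path_edges 4 \<longleftrightarrow> y = Suc x \<or> x = Suc y"
        using that by (auto simp: path_edges_def doubleton_eq_iff)
      have "{?f x, ?f y} \<in> induced_edges E ?W \<longleftrightarrow> {?f x, ?f y} \<in> E"
        using that unfolding lt4 by (auto simp: induced_edges_def)
      also have "\<dots> \<longleftrightarrow> y = Suc x \<or> x = Suc y"
      proof -
        have "x = 0 \<or> x = 1 \<or> x = 2 \<or> x = 3" "y = 0 \<or> y = 1 \<or> y = 2 \<or> y = 3"
          using that unfolding lt4 by simp_all
        then show ?thesis
          by (elim disjE) (simp_all add: edges edges' False False' loop)
      qed
      finally show ?thesis using path by simp
    qed
    ultimately have "graph_isomorphic {..<4} (path_edges 4) ?W (induced_edges E ?W)"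
      unfolding graph_isomorphic_def by blast
    then show False using hom unfolding homogeneous_chordal_def by blast
  qed
qed

text \<open>
  Match the sorted list of all elements with a list of all elements sorted by \<open>d\<close>.
\<close>
lemma ex_bij_mono_comp:
  fixes d :: "'n::{finite,linorder} \<Rightarrow> nat"
  obtains p :: "'n \<Rightarrow> 'n" where "bij p" "mono (d \<circ> p)"
proof -
  define xs where "xs = sorted_list_of_set (UNIV :: 'n set)"
  define ys where "ys = sort_key d xs"
  have xs: "distinct xs" "set xs = UNIV" "sorted xs" "length xs = CARD('n)" by (auto simp: xs_def)
  have ys: "distinct ys" "set ys = UNIV" "length ys = CARD('n)" "sorted (map d ys)"
    by (auto simp: ys_def xs)
  have X: "bij_betw ((!) xs) {..<CARD('n)} UNIV" using bij_betw_nth[OF xs(1)] xs by auto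
  have Y: "bij_betw ((!) ys) {..<CARD('n)} UNIV" using bij_betw_nth[OF ys(1)] ys by auto
  define idx where "idx = inv_into {..<CARD('n)} ((!) xs)"
  have idx: "bij_betw idx UNIV {..<CARD('n)}" unfolding idx_def by (rule bij_betw_inv_into[OF X])
  have idx_xs: "xs ! idx i = i" "idx i < CARD('n)" for i
    using X idx bij_betw_apply[OF idx, of i] by (auto simp: idx_def bij_betw_def f_inv_into_f)
  have "bij ((!) ys \<circ> idx)" by (rule bij_betw_trans[OF idx Y])
  moreover have "mono (d \<circ> ((!) ys \<circ> idx))"
  proof (rule monoI)
    fix i k :: 'n assume "i \<le> k"
    have "idx i \<le> idx k"
    proof (rule ccontr)
      assume "\<not> idx i \<le> idx k"
      then have "xs ! idx k \<le> xs ! idx i"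
        using sorted_nth_mono[OF xs(3), of "idx k" "idx i"] idx_xs(2) xs(4) by simp
      with \<open>i \<le> k\<close> \<open>\<not> idx i \<le> idx k\<close> show False by (simp add: idx_xs(1))
    qed
    then show "(d \<circ> ((!) ys \<circ> idx)) i \<le> (d \<circ> ((!) ys \<circ> idx)) k"
      using sorted_nth_mono[OF ys(4), of "idx i" "idx k"] idx_xs(2) ys(3) by simp
  qed
  ultimately show ?thesis by (rule that)
qed

text \<open>
  Sort the vertices by the size of their closed neighbourhoods: adjacent vertices have comparable
  neighbourhoods, and for comparable finite sets the one of larger or equal size is the larger one.
\<close>
lemma homogeneous_chordal_relabelling:
  fixes E :: "'n::{finite,linorder} set set"
  assumes "simple_graph E" "homogeneous_chordal E"
  obtains p :: "'n \<Rightarrow> 'n" where "bij p" "trivially_perfect_elim_ordering {e. p ` e \<in> E}"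
proof -
  obtain p :: "'n \<Rightarrow> 'n" where p: "bij p" "mono ((\<lambda>i. card (closed_nbhd E i)) \<circ> p)"
    using ex_bij_mono_comp by metis
  have inj: "p i = p j \<longleftrightarrow> i = j" for i j using p(1) by (auto simp: bij_def inj_eq)
  have nbhd: "j \<in> closed_nbhd {e. p ` e \<in> E} i \<longleftrightarrow> p j \<in> closed_nbhd E (p i)" for i j
    by (simp add: closed_nbhd_def inj)
  have "closed_nbhd E (p i) \<subseteq> closed_nbhd E (p j)" if "p j \<in> closed_nbhd E (p i)" "i \<le> j" for i j
  proof -
    have card: "card (closed_nbhd E (p i)) \<le> card (closed_nbhd E (p j))"
      using monoD[OF p(2) that(2)] by simp
    from homogeneous_chordal_nested[OF assms that(1)] show ?thesis
    proof
      assume "closed_nbhd E (p j) \<subseteq> closed_nbhd E (p i)"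
      then have "closed_nbhd E (p j) = closed_nbhd E (p i)" using card by (intro card_seteq) auto
      then show ?thesis by simp
    qed
  qed
  then have "trivially_perfect_elim_ordering {e. p ` e \<in> E}"
    unfolding tpeo_iff_nested subset_iff nbhd by blast
  with p(1) show ?thesis by (rule that)
qed

definition relabel :: "('n \<Rightarrow> 'n) \<Rightarrow> real^'n^'n \<Rightarrow> real^'n^'n" where
  "relabel p A = (\<chi> i j. A $ p i $ p j)"

lemma relabel_nth [simp]: "relabel p A $ i $ j = A $ p i $ p j"
  by (simp add: relabel_def)

lemma relabel_inverse:
  assumes "bij p"
  shows "relabel p (relabel (inv p) A) = A" and "relabel (inv p) (relabel p A) = A"
  using assms by (simp_all add: vec_eq_iff bij_is_inj bij_is_surj surj_f_inv_f)

lemma psd_relabel: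
  assumes p: "bij p" and A: "psd A"
  shows "psd (relabel p A)"
proof -
  have "v \<bullet> (relabel p A *v v) = (\<chi> i. v $ inv p i) \<bullet> (A *v (\<chi> i. v $ inv p i))" for v
  proof -
    have "v \<bullet> (relabel p A *v v) = (\<Sum>i\<in>UNIV. v $ i * (\<Sum>j\<in>UNIV. A $ p i $ p j * v $ j))"
      by (simp add: inner_vec_def matrix_vector_mult_def)
    also have "\<dots> = (\<Sum>i\<in>UNIV. v $ inv p i * (\<Sum>j\<in>UNIV. A $ i $ j * v $ inv p j))"
    proof -
      have "(\<Sum>j\<in>UNIV. A $ p i $ p j * v $ j) = (\<Sum>j\<in>UNIV. A $ p i $ j * v $ inv p j)" for i
        using sum.reindex_bij_betw[of p UNIV UNIV "\<lambda>j. A $ p i $ j * v $ inv p j"] p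
        by (simp add: bij_is_inj)
      then show ?thesis
        using sum.reindex_bij_betw[of p UNIV UNIV "\<lambda>i. v $ inv p i * (\<Sum>j\<in>UNIV. A $ i $ j * v $ inv p j)"] p
        by (simp add: bij_is_inj)
    qed
    finally show ?thesis by (simp add: inner_vec_def matrix_vector_mult_def)
  qed
  then show ?thesis using A psd_sym[OF A] by (simp add: psd_def transpose_def vec_eq_iff)
qed

lemma relabel_pattern_proj: 
  assumes "bij p"
  shows "relabel p (pattern_proj E A) = pattern_proj {e. p ` e \<in> E} (relabel p A)"
proof -
  have "p i = p j \<longleftrightarrow> i = j" for i j using assms by (auto simp: bij_def inj_eq)
  then show ?thesis by (simp add: vec_eq_iff pattern_proj_def)
qed

lemma relabel_pattern_cone:
  assumes "bij p"
  shows "relabel p ` pattern_cone E = pattern_cone {e. p ` e \<in> E}"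
proof
  show "relabel p ` pattern_cone E \<subseteq> pattern_cone {e. p ` e \<in> E}"
    using assms by (auto simp: pattern_cone_def relabel_pattern_proj psd_relabel)
  show "pattern_cone {e. p ` e \<in> E} \<subseteq> relabel p ` pattern_cone E"
  proof
    fix y assume "y \<in> pattern_cone {e. p ` e \<in> E}"
    then obtain w where w: "psd w" "y = pattern_proj {e. p ` e \<in> E} w" by (auto simp: pattern_cone_def)
    have "y = relabel p (pattern_proj E (relabel (inv p) w))"
      using assms by (simp add: relabel_pattern_proj relabel_inverse w(2))
    moreover have "psd (relabel (inv p) w)" using assms w(1) by (simp add: psd_relabel bij_imp_bij_inv)
    ultimately show "y \<in> relabel p ` pattern_cone E" by (auto simp: pattern_cone_def)
  qed
qed

lemma relabel_cone_iso:
  assumes p: "bij p"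
  shows "cone_iso (pattern_space E) (pattern_cone E)
    (pattern_space {e. p ` e \<in> E}) (pattern_cone {e. p ` e \<in> E}) (relabel p)"
proof -
  have inj: "p i = p j \<longleftrightarrow> i = j" for i j using p by (auto simp: bij_def inj_eq)
  have "relabel p A \<in> pattern_space {e. p ` e \<in> E}" if "A \<in> pattern_space E" for A
    using that by (simp add: pattern_space_def transpose_def vec_eq_iff inj)
  moreover have "relabel (inv p) A \<in> pattern_space E" if "A \<in> pattern_space {e. p ` e \<in> E}" for A
  proof -
    have "p (inv p i) = i" for i using p by (simp add: bij_is_surj surj_f_inv_f)
    moreover have "inv p i = inv p j \<longleftrightarrow> i = j" for i j using calculation by metis
    ultimately show ?thesis using that by (simp add: pattern_space_def transpose_def vec_eq_iff)
  qed
  ultimately have "bij_betw (relabel p) (pattern_space E) (pattern_space {e. p ` e \<in> E})"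
    by (intro bij_betw_byWitness[where f' = "relabel (inv p)"]) (auto simp: relabel_inverse[OF p])
  then show ?thesis
    by (simp add: cone_iso_def relabel_pattern_cone[OF p] vec_eq_iff)
qed

lemma relabel_sub_cone:
  assumes p: "bij p"
  shows "relabel p ` sub_cone E (p ` W) = sub_cone {e. p ` e \<in> E} W"
proof -
  have cone: "relabel p x \<in> pattern_cone {e. p ` e \<in> E} \<longleftrightarrow> x \<in> pattern_cone E" for x
    using relabel_pattern_cone[OF p, of E] relabel_inverse(2)[OF p] by (metis imageE imageI)
  have all: "(\<forall>i. P i) \<longleftrightarrow> (\<forall>i. P (p i))" for P using p by (metis bij_pointE)
  have mem: "p i \<in> p ` W \<longleftrightarrow> i \<in> W" for i using p by (simp add: bij_is_inj inj_image_mem_iff)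
  have iff: "relabel p x \<in> sub_cone {e. p ` e \<in> E} W \<longleftrightarrow> x \<in> sub_cone E (p ` W)" for x
  proof -
    have "(\<forall>i j. i \<notin> p ` W \<and> j \<notin> p ` W \<longrightarrow> x $ i $ j = 0 \<and> x $ j $ i = 0) \<longleftrightarrow>
        (\<forall>i j. p i \<notin> p ` W \<and> p j \<notin> p ` W \<longrightarrow> x $ p i $ p j = 0 \<and> x $ p j $ p i = 0)"
      by (subst all, subst all, rule refl)
    then show ?thesis by (simp add: sub_cone_def cone mem)
  qed
  show ?thesis
  proof
    show "relabel p ` sub_cone E (p ` W) \<subseteq> sub_cone {e. p ` e \<in> E} W" using iff by blast
    show "sub_cone {e. p ` e \<in> E} W \<subseteq> relabel p ` sub_cone E (p ` W)"
      using iff relabel_inverse(1)[OF p] by (metis image_eqI subsetI)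
  qed
qed

text \<open>
  Relabel the vertices, bring the face to coordinate form there, and undo the relabelling; the
  composition is an automorphism of the original cone.
\<close>
lemma homogeneous_chordal_face_automorphism:
  fixes E :: "'n::{finite,linorder} set set"
  assumes G: "simple_graph E" "homogeneous_chordal E" and F: "cone_face F (pattern_cone E)"
  obtains Q W where "cone_automorphism (pattern_space E) (pattern_cone E) Q" "Q ` F = sub_cone E W"
proof -
  obtain p :: "'n \<Rightarrow> 'n" where p: "bij p" and tpeo: "trivially_perfect_elim_ordering {e. p ` e \<in> E}"
    using homogeneous_chordal_relabelling[OF G] .
  define E' where "E' = {e. p ` e \<in> E}"
  note tpeo' = tpeo[folded E'_def]
  note R = relabel_cone_iso[OF p, of E, folded E'_def]
  note S = subspace_pattern_space[of E] pattern_cone_subset_space[of E]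
  have "cone_face (relabel p ` F) (pattern_cone E')"
    by (rule cone_face_cone_iso[OF R S F])
  then obtain u W where u: "u \<in> T_plusplus E'" "Q_map E' u ` relabel p ` F = sub_cone E' W"
    using face_normal_form[OF tpeo'] by metis
  let ?g = "inv_into (pattern_space E) (relabel p)"
  have "cone_iso (pattern_space E) (pattern_cone E) (pattern_space E) (pattern_cone E)
      (?g \<circ> (Q_map E' u \<circ> relabel p))"
    by (intro cone_iso_comp[OF cone_iso_comp[OF R Q_map_cone_iso[OF tpeo' u(1)]]] cone_iso_inv[OF R S])
  moreover have "(?g \<circ> (Q_map E' u \<circ> relabel p)) ` F = sub_cone E (p ` W)"
  proof -
    have "(?g \<circ> (Q_map E' u \<circ> relabel p)) ` F = ?g ` (Q_map E' u ` relabel p ` F)"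
      by (simp add: image_comp)
    also have "\<dots> = ?g ` relabel p ` sub_cone E (p ` W)"
      by (simp only: u(2) relabel_sub_cone[OF p, of E W, folded E'_def])
    also have "\<dots> = sub_cone E (p ` W)"
      using R S(2) by (intro inv_into_image_cancel) (auto simp: cone_iso_def bij_betw_def sub_cone_def)
    finally show ?thesis .
  qed
  ultimately show ?thesis using that by (simp add: cone_automorphism_iff_cone_iso)
qed

section \<open>Faces are automorphic images of coordinate faces\<close>

theorem theorem4p4:
  fixes E :: "'n::{finite,linorder} set set"
    and F :: "(real^'n::_^'n::_) set"
  assumes "simple_graph E"
    and "homogeneous_chordal E"
    and "cone_face F (pattern_cone E)"
  shows
    "projectionally_exposed (pattern_space E) (pattern_cone E) F \<and>
     (\<exists>Q W. cone_automorphism (pattern_space E) (pattern_cone E) Q \<and> Q ` F = sub_cone E W) \<and>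
     (trivially_perfect_elim_ordering E \<longrightarrow>
        (\<exists>u\<in>T_plusplus E. \<exists>W.
            cone_automorphism (pattern_space E) (pattern_cone E) (Q_map E u) \<and>
            Q_map E u ` F = sub_cone E W) \<and>
        (\<forall>u\<in>T_plusplus E. \<forall>y\<in>pattern_cone E.
            Q_map E u y = pattern_proj E (u ** y ** transpose u)) \<and>
        (\<forall>x\<in>rel_interior F.
            (\<exists>!t. t \<in> T_plus E \<and> proper_matrix t \<and> x = pattern_proj E (t ** transpose t)) \<and>
            (\<forall>t. t \<in> T_plus E \<and> proper_matrix t \<and> x = pattern_proj E (t ** transpose t) \<longrightarrow>
               (\<forall>u\<in>T_plusplus E. \<forall>W. Q_map E u ` F = sub_cone E W \<longrightarrow> W = - zero_diag t) \<and>
               (\<exists>u\<in>T_plusplus E. u ** t = e_mat (zero_diag t)) \<and>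
               (\<forall>u\<in>T_plusplus E. u ** t = e_mat (zero_diag t) \<longrightarrow>
                  cone_automorphism (pattern_space E) (pattern_cone E) (Q_map E u) \<and>
                  Q_map E u ` F = sub_cone E (- zero_diag t)) \<and>
               rank (t ** transpose t) = card {i. t $ i $ i \<noteq> 0} \<and>
               is_max_rank_completion E x (t ** transpose t) \<and>
               (card {i. t $ i $ i \<noteq> 0} = CARD('n) \<longrightarrow>
                  is_max_det_completion E x (t ** transpose t) \<and>
                  (\<forall>w. is_max_det_completion E x w \<longrightarrow> w = t ** transpose t)))))"
proof (intro conjI impI)
  have FK: "F \<subseteq> pattern_cone E" using assms(3) by (simp add: cone_face_def)
  then have FS: "F \<subseteq> pattern_space E" using pattern_cone_subset_space by blast
  obtain Q W where Q: "cone_automorphism (pattern_space E) (pattern_cone E) Q" "Q ` F = sub_cone E W"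
    using homogeneous_chordal_face_automorphism[OF assms] .
  then show "\<exists>Q W. cone_automorphism (pattern_space E) (pattern_cone E) Q \<and> Q ` F = sub_cone E W"
    by blast
  have "projectionally_exposed (pattern_space E) (pattern_cone E) (Q ` F)"
    unfolding Q(2) by (rule projectionally_exposed_sub_cone)
  then show "projectionally_exposed (pattern_space E) (pattern_cone E) F"
    using Q(1) unfolding cone_automorphism_iff_cone_iso
    by (intro projectionally_exposed_cone_iso[OF _ subspace_pattern_space pattern_cone_subset_space FS])
  assume tpeo: "trivially_perfect_elim_ordering E"
  have auto: "cone_automorphism (pattern_space E) (pattern_cone E) (Q_map E u)" if "u \<in> T_plusplus E" for u
    using Q_map_cone_iso[OF tpeo that] by (simp add: cone_automorphism_iff_cone_iso)
  show "\<exists>u\<in>T_plusplus E. \<exists>W. cone_automorphism (pattern_space E) (pattern_cone E) (Q_map E u) \<and>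
      Q_map E u ` F = sub_cone E W"
    using face_normal_form[OF tpeo assms(3)] auto by metis
  show "\<forall>u\<in>T_plusplus E. \<forall>y\<in>pattern_cone E. Q_map E u y = pattern_proj E (u ** y ** transpose u)"
    by (intro ballI Q_map_eq_congruence[OF tpeo] subsetD[OF pattern_cone_subset_space])
      (simp_all add: T_plusplus_iff)
  show "\<forall>x\<in>rel_interior F.
      (\<exists>!t. t \<in> T_plus E \<and> proper_matrix t \<and> x = pattern_proj E (t ** transpose t)) \<and>
      (\<forall>t. t \<in> T_plus E \<and> proper_matrix t \<and> x = pattern_proj E (t ** transpose t) \<longrightarrow>
         (\<forall>u\<in>T_plusplus E. \<forall>W. Q_map E u ` F = sub_cone E W \<longrightarrow> W = - zero_diag t) \<and>
         (\<exists>u\<in>T_plusplus E. u ** t = e_mat (zero_diag t)) \<and>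
         (\<forall>u\<in>T_plusplus E. u ** t = e_mat (zero_diag t) \<longrightarrow>
            cone_automorphism (pattern_space E) (pattern_cone E) (Q_map E u) \<and>
            Q_map E u ` F = sub_cone E (- zero_diag t)) \<and>
         rank (t ** transpose t) = card {i. t $ i $ i \<noteq> 0} \<and>
         is_max_rank_completion E x (t ** transpose t) \<and>
         (card {i. t $ i $ i \<noteq> 0} = CARD('n) \<longrightarrow>
            is_max_det_completion E x (t ** transpose t) \<and>
            (\<forall>w. is_max_det_completion E x w \<longrightarrow> w = t ** transpose t)))"
  proof (intro ballI conjI allI impI)
    fix x assume "x \<in> rel_interior F"
    then have "x \<in> pattern_cone E" using FK rel_interior_subset by blast
    from pattern_cone_triangular_factor[OF tpeo this] obtain t
      where "t \<in> T_plus E" "proper_matrix t" "x = pattern_proj E (t ** transpose t)" .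
    then show "\<exists>!t. t \<in> T_plus E \<and> proper_matrix t \<and> x = pattern_proj E (t ** transpose t)"
      using triangular_factor_unique[of _ E t] by (intro ex1I[of _ t]) auto
  next
    fix x t
    assume x: "x \<in> rel_interior F"
      and "t \<in> T_plus E \<and> proper_matrix t \<and> x = pattern_proj E (t ** transpose t)"
    then have t: "t \<in> T_plus E" "proper_matrix t" and xt: "x = pattern_proj E (t ** transpose t)"
      by simp_all
    have compl: "{i. t $ i $ i \<noteq> 0} = - zero_diag t" by (auto simp: zero_diag_def)
    obtain u where u: "u \<in> T_plusplus E" "u ** t = e_mat (zero_diag t)"
      using triangular_factor_normalizer[OF tpeo t] .
    then show "\<exists>u\<in>T_plusplus E. u ** t = e_mat (zero_diag t)" by blast
    have image: "Q_map E u ` F = sub_cone E (- zero_diag t)"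
      if "u \<in> T_plusplus E" "u ** t = e_mat (zero_diag t)" for u
      using Q_map_face[OF tpeo assms(3) _ that] x xt by simp
    show "W = - zero_diag t" if "u' \<in> T_plusplus E" "Q_map E u' ` F = sub_cone E W" for u' W
      using Q_map_sub_cone_unique[OF tpeo FS that u(1) image[OF u]]
        Q_map_sub_cone_unique[OF tpeo FS u(1) image[OF u] that] by (rule equalityI)
    show "cone_automorphism (pattern_space E) (pattern_cone E) (Q_map E u)" if "u \<in> T_plusplus E" for u
      using that by (rule auto)
    show "Q_map E u ` F = sub_cone E (- zero_diag t)"
      if "u \<in> T_plusplus E" "u ** t = e_mat (zero_diag t)" for u
      using that by (rule image)
    show "rank (t ** transpose t) = card {i. t $ i $ i \<noteq> 0}"
      unfolding compl by (rule rank_triangular_product[OF tpeo t])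
    show "is_max_rank_completion E x (t ** transpose t)"
      unfolding xt by (rule triangular_product_max_rank[OF tpeo t])
    have nonsing: "zero_diag t = {}" if "card {i. t $ i $ i \<noteq> 0} = CARD('n)"
    proof -
      have "- zero_diag t = UNIV"
        using that unfolding compl by (intro card_subset_eq) simp_all
      then show ?thesis by blast
    qed
    show "is_max_det_completion E x (t ** transpose t)" if "card {i. t $ i $ i \<noteq> 0} = CARD('n)"
      unfolding xt by (rule triangular_product_max_det(1)[OF tpeo t nonsing[OF that]])
    show "w = t ** transpose t"
      if "card {i. t $ i $ i \<noteq> 0} = CARD('n)" "is_max_det_completion E x w" for w
      using that(2) unfolding xt by (rule triangular_product_max_det(2)[OF tpeo t nonsing[OF that(1)]])
  qed
qed

end
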